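(* Let $Q=(\mathbb{R}/2\pi\mathbb{Z})^d$, $T>0$. Consider $\partial_tv+\mathrm{div}_xf(v)=0$, $v\in\mathbb{R}^n$, with $f\in C^2$, endowed with a $C^2$ entropy–entropy flux pair $(\eta,q)$ satisfying $\frac{\partial\eta}{\partial v_j}\frac{\partial f_{j\alpha}}{\partial v_i}=\frac{\partial q_\alpha}{\partial v_i}$, where $\eta$ is positive and strictly convex with $D^2\eta\ge\gamma_0>0$, $\alpha_0(|\lambda|^p+1)-A\le\eta(\lambda)\le C(|\lambda|^p+1)$ for all $\lambda$ (some $p\in[2,\infty)$, constants $\alpha_0,A,C>0$), and $|f(\lambda)|/\eta(\lambda)\to0$ as $|\lambda|\to\infty$. Let $(v,\nu,\gamma)$ be a dissipative measure-valued solution with concentration: there are sequences $v^\epsilon$ (bounded in $L^\infty(L^p)$) and initial data $v_0^\epsilon$ such that $g(v^\epsilon)\rightharpoonup\langle\nu_{x,t},g\rangle$ and $g(v_0^\epsilon)\rightharpoonup\langle\mu_x,g\rangle$ for all continuous $g$ with $g/\eta\to0$ at infinity, and $\eta(v^\epsilon)dx\,dt\rightharpoonup\langle\nu_{x,t},\eta\rangle dx\,dt+\gamma(dx\,dt)$, $\eta(v_0^\epsilon)dx\rightharpoonup\langle\mu_x,\eta\rangle dx+\zeta(dx)$, with Young measures $\nu,\mu$ and Radon measures $\gamma\ge0,\zeta\ge0$; $v=\langle\nu,\lambda\rangle\in L^\infty(L^p)$, $v_0=\langle\mu_x,\lambda\rangle$; and $$\iint\langle\nu_{x,t},\lambda\rangle\psi_t+\langle\nu_{x,t},f(\lambda)\rangle\psi_x\,dx\,dt+\int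 v_0(x)\psi(x,0)dx=0\quad\forall\psi\in C^1_c(Q\times[0,T)),$$ $$\iint\dot\theta\big(\langle\nu_{x,t},\eta\rangle dx\,dt+\gamma(dx\,dt)\big)+\int\theta(0)\big(\langle\mu_x,\eta\rangle dx+\zeta(dx)\big)\ge0\quad\forall\theta\in C^1_c([0,T)),\ \theta\ge0.$$ If $\zeta\equiv0$ and $\mu_x=\delta_{v_0(x)}$, then as $\tau\to0^+$, $$\frac1\tau\int_0^\tau v(\cdot,t)\,dt\to v_0\quad\text{strongly in }L^p(Q).$$
   Context: Summation convention; the flux term means $\partial_{x_\alpha}\psi_i\langle\nu,f_{i\alpha}\rangle$ summed. *)

theory Defs
  imports "HOL-Probability.Probability"
begin

text \<open>The torus Q = (R / 2 pi Z)^d is represented by the fundamental domain [0, 2 pi)^d;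
  functions on the torus are 2 pi-periodic functions on R^d.\<close>

definition torusQ :: "(real^'d) set" where
  "torusQ = {x. \<forall>i. 0 \<le> x $ i \<and> x $ i < 2 * pi}"

definition periodic_x :: "(real^'d \<Rightarrow> 'b) \<Rightarrow> bool" where
  "periodic_x g \<longleftrightarrow> (\<forall>x i. g (x + (2 * pi) *\<^sub>R axis i 1) = g x)"

definition periodic_xt :: "((real^'d) \<times> real \<Rightarrow> 'b) \<Rightarrow> bool" where
  "periodic_xt g \<longleftrightarrow> (\<forall>t. periodic_x (\<lambda>x. g (x, t)))"

definition pd :: "('a::real_normed_vector \<Rightarrow> 'b::real_normed_vector) \<Rightarrow> 'a \<Rightarrow> 'a \<Rightarrow> 'b" where
  "pd g e z = vector_derivative (\<lambda>h. g (z + h *\<^sub>R e)) (at 0)"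

definition C1 :: "('a::euclidean_space \<Rightarrow> 'b::real_normed_vector) \<Rightarrow> bool" where
  "C1 g \<longleftrightarrow> (\<forall>e\<in>Basis. (\<forall>z. (\<lambda>h. g (z + h *\<^sub>R e)) differentiable (at 0))
                       \<and> continuous_on UNIV (pd g e))"

definition C2 :: "('a::euclidean_space \<Rightarrow> 'b::real_normed_vector) \<Rightarrow> bool" where
  "C2 g \<longleftrightarrow> C1 g \<and> (\<forall>e\<in>Basis. C1 (pd g e))"

definition strictly_convex :: "('a::real_vector \<Rightarrow> real) \<Rightarrow> bool" where
  "strictly_convex g \<longleftrightarrow> (\<forall>x y u. x \<noteq> y \<and> 0 < u \<and> u < 1 \<longrightarrow>
      g ((1 - u) *\<^sub>R x + u *\<^sub>R y) < (1 - u) * g x + u * g y)"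

definition pair :: "'a measure \<Rightarrow> ('a \<Rightarrow> 'b::{banach,second_countable_topology}) \<Rightarrow> 'b" where
  "pair m g = integral\<^sup>L m g"

definition cont_test_xt :: "((real^'d) \<times> real \<Rightarrow> real) set" where
  "cont_test_xt = {\<phi>. continuous_on UNIV \<phi> \<and> periodic_xt \<phi>}"

definition cont_test_x :: "(real^'d \<Rightarrow> real) set" where
  "cont_test_x = {\<phi>. continuous_on UNIV \<phi> \<and> periodic_x \<phi>}"

definition C1c_test :: "real \<Rightarrow> ((real^'d) \<times> real \<Rightarrow> real^'n) set" where
  "C1c_test T = {\<psi>. C1 \<psi> \<and> periodic_xt \<psi> \<and> (\<exists>T'<T. \<forall>x t. t \<ge> T' \<longrightarrow> \<psi> (x, t) = 0)}"

definition C1c_time_nonneg :: "real \<Rightarrow> (real \<Rightarrow> real) set" where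
  "C1c_time_nonneg T = {\<theta>. C1 \<theta> \<and> (\<forall>t. \<theta> t \<ge> 0) \<and> (\<exists>T'<T. \<forall>t. t \<ge> T' \<longrightarrow> \<theta> t = 0)}"

definition young_measure :: "('x::euclidean_space \<Rightarrow> 'a::topological_space measure) \<Rightarrow> bool" where
  "young_measure \<nu> \<longleftrightarrow> (\<forall>z. prob_space (\<nu> z) \<and> sets (\<nu> z) = sets borel) \<and>
      (\<forall>A\<in>sets borel. (\<lambda>z. emeasure (\<nu> z) A) \<in> borel_measurable lborel)"

end

theory Submission
  imports Defs
begin

text \<open>
  Write \<open>w\<^sub>\<tau>\<close> for the average of \<open>v\<close> over \<open>[0, \<tau>]\<close> and
  \<open>E(a, b) = \<eta>(a) - \<eta>(b) - D\<eta>(b)(a - b)\<close> for the relative entropy.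
  Testing the entropy inequality with a smoothed ramp \<open>(1 - t/\<tau>)\<^sub>+\<close> and applying Jensen's inequality
  gives \<open>\<integral>\<eta>(w\<^sub>\<tau>) \<le> \<integral>\<eta>(v\<^sub>0)\<close>; testing the conservation law with the same ramp times a function of
  \<open>x\<close> gives \<open>w\<^sub>\<tau> \<rightharpoonup> v\<^sub>0\<close>, first against smooth periodic functions and then, by a
  Dynkin class argument, against indicators of Borel sets. Hence
  \<open>limsup \<integral>E(w\<^sub>\<tau>, s) \<le> \<integral>E(v\<^sub>0, s)\<close> for every simple function \<open>s\<close>, and the right-hand side can be made
  arbitrarily small. Since \<open>E(a, b)\<close> dominates \<open>|a - b|\<^sup>p\<close> uniformly for bounded \<open>b\<close>, strong
  convergence follows: where \<open>v\<^sub>0\<close> is bounded one takes \<open>s\<close> close to \<open>v\<^sub>0\<close>, and where \<open>v\<^sub>0\<close> is large one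
  takes \<open>s = 0\<close>, so that no constant depends on the cut-off there.
\<close>

section \<open>Continuously differentiable functions and relative entropy\<close>

text \<open>Only the sign of the concentration measure \<gamma> is exploited. The test function must
  also be C1, hence the smoothing, which is removed at fixed \<tau>, before \<tau> tends to 0. In
  the conservation law the flux meets the ramp itself and not its time derivative, so it contributes
  at most an integral of an integrable function over the cylinder of height \<tau>, and that
  vanishes in the limit.

  The comparison function \<open>s\<close> is simple because weak convergence is available only
  against bounded functions of \<open>x\<close>: the linear term D\<eta>(s)(w - v0) becomes a finite
  combination of pairings with indicators of level sets. The step from periodic tests to indicators
  rests on an L2 bound uniform in \<tau>, which follows from the entropy bound because
  \<open>p \<ge> 2\<close>: on a space of finite measure, bounded a.e. limits of test functions are
  L2 limits.\<close>

lemma C1_line_derivative: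
  assumes "C1 g" "e \<in> Basis"
  shows "((\<lambda>s. g (z + s *\<^sub>R e)) has_vector_derivative pd g e (z + s *\<^sub>R e)) (at s)"
proof -
  have "((\<lambda>h. g ((z + s *\<^sub>R e) + h *\<^sub>R e)) has_vector_derivative pd g e (z + s *\<^sub>R e)) (at 0)"
    using assms unfolding C1_def pd_def by (simp add: vector_derivative_works)
  then have "((\<lambda>h. g (z + (s + h) *\<^sub>R e)) has_vector_derivative pd g e (z + s *\<^sub>R e)) (at 0)"
    by (simp add: algebra_simps)
  then have "((\<lambda>h. g (z + (s + h) *\<^sub>R e)) \<circ> (\<lambda>r. r - s) has_vector_derivative 1 *\<^sub>R pd g e (z + s *\<^sub>R e)) (at s)"
    by (intro vector_diff_chain_at) (auto intro!: derivative_eq_intros)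
  then show ?thesis by (simp add: o_def)
qed

text \<open>\<open>C1\<close> speaks of partial derivatives only, so the Frechet derivative has to
  be recovered: the coordinates of the increment are switched on one at a time, and each switch is
  controlled by the mean value inequality and the continuity of that partial derivative at
  \<open>z\<close>.\<close>

lemma C1_has_derivative:
  fixes g :: "'a::euclidean_space \<Rightarrow> 'b::real_normed_vector"
  assumes "C1 g"
  shows "(g has_derivative (\<lambda>h. \<Sum>e\<in>Basis. (h \<bullet> e) *\<^sub>R pd g e z)) (at z)"
proof -
  have partial: "\<forall>\<epsilon>>0. \<exists>\<delta>>0. \<forall>h. norm h < \<delta> \<longrightarrow>
      norm (g (z + (\<Sum>e\<in>B. (h \<bullet> e) *\<^sub>R e)) - g z - (\<Sum>e\<in>B. (h \<bullet> e) *\<^sub>R pd g e z)) \<le> \<epsilon> * norm h"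
    if "B \<subseteq> Basis" for B
    using finite_subset[OF that finite_Basis] that
  proof (induction B rule: finite_induct)
    case empty
    then show ?case by (auto intro!: exI[of _ 1])
  next
    case (insert b B)
    have b: "b \<in> Basis" using insert by auto
    show ?case
    proof (intro allI impI)
      fix \<epsilon> :: real assume \<epsilon>: "\<epsilon> > 0"
      obtain \<delta>1 where \<delta>1: "\<delta>1 > 0" "\<And>h. norm h < \<delta>1 \<Longrightarrow>
          norm (g (z + (\<Sum>e\<in>B. (h \<bullet> e) *\<^sub>R e)) - g z - (\<Sum>e\<in>B. (h \<bullet> e) *\<^sub>R pd g e z)) \<le> \<epsilon>/2 * norm h"
        using insert.IH[rule_format, of "\<epsilon>/2"] insert.prems \<epsilon> by auto
      have "continuous_on UNIV (pd g b)" using assms b by (auto simp: C1_def)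
      then have "isCont (pd g b) z" by (simp add: continuous_on_eq_continuous_at)
      then obtain \<rho> where \<rho>: "\<rho> > 0" "\<And>x. dist x z < \<rho> \<Longrightarrow> dist (pd g b x) (pd g b z) < \<epsilon>/2"
        unfolding continuous_at_eps_delta using \<epsilon> by (meson half_gt_zero)
      \<comment> \<open>\<open>card B\<close> times the norm of \<open>h\<close> bounds the
        displacement caused by the coordinates already in \<open>B\<close>; the extra 1 is for the
        move along \<open>b\<close>.\<close>
      define N where "N = real (card B) + 1"
      have N: "N > 0" by (simp add: N_def add_nonneg_pos)
      show "\<exists>\<delta>>0. \<forall>h. norm h < \<delta> \<longrightarrow> norm (g (z + (\<Sum>e\<in>insert b B. (h \<bullet> e) *\<^sub>R e)) - g z -
               (\<Sum>e\<in>insert b B. (h \<bullet> e) *\<^sub>R pd g e z)) \<le> \<epsilon> * norm h"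
      proof (intro exI[of _ "min \<delta>1 (\<rho> / N)"] conjI allI impI)
        show "0 < min \<delta>1 (\<rho> / N)" using \<delta>1 \<rho> N by simp
        fix h :: 'a assume h: "norm h < min \<delta>1 (\<rho> / N)"
        define y where "y = z + (\<Sum>e\<in>B. (h \<bullet> e) *\<^sub>R e)"
        \<comment> \<open>Removing the linear part frozen at \<open>z\<close> leaves a function of
          \<open>s\<close> whose derivative is the oscillation of \<open>pd g b\<close> near
          \<open>z\<close>, hence at most \<open>\<epsilon>/2\<close>.\<close>
        define \<phi> where "\<phi> s = g (y + s *\<^sub>R b) - s *\<^sub>R pd g b z" for s
        have hb: "\<bar>h \<bullet> e\<bar> \<le> norm h" if "e \<in> Basis" for e
          using that by (rule Basis_le_norm)
        have yz: "norm (y - z) \<le> card B * norm h"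
        proof -
          have "norm (y - z) \<le> (\<Sum>e\<in>B. norm ((h \<bullet> e) *\<^sub>R e))"
            unfolding y_def by (simp add: norm_sum del: norm_scaleR)
          also have "\<dots> \<le> (\<Sum>e\<in>B. norm h)"
            using insert.prems hb by (intro sum_mono) auto
          finally show ?thesis by simp
        qed
        have "norm (\<phi> (h \<bullet> b) - \<phi> 0) \<le> \<epsilon>/2 * norm (h \<bullet> b - 0)"
        proof (rule differentiable_bound[where S="closed_segment 0 (h \<bullet> b)" and f'="\<lambda>s r. r *\<^sub>R (pd g b (y + s *\<^sub>R b) - pd g b z)"])
          fix s assume s: "s \<in> closed_segment 0 (h \<bullet> b)"
          have "(\<phi> has_vector_derivative (pd g b (y + s *\<^sub>R b) - pd g b z)) (at s within closed_segment 0 (h \<bullet> b))"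
            unfolding \<phi>_def
            by (rule derivative_eq_intros has_vector_derivative_at_within[OF C1_line_derivative[OF assms b]] | simp)+
          then show "(\<phi> has_derivative (\<lambda>r. r *\<^sub>R (pd g b (y + s *\<^sub>R b) - pd g b z))) (at s within closed_segment 0 (h \<bullet> b))"
            by (simp add: has_vector_derivative_def)
          have s': "\<bar>s\<bar> \<le> norm h"
            using s hb[OF b] by (auto simp: closed_segment_eq_real_ivl split: if_splits)
          have "dist (y + s *\<^sub>R b) z \<le> norm (y - z) + \<bar>s\<bar>"
            using norm_triangle_ineq[of "y - z" "s *\<^sub>R b"] b by (simp add: dist_norm algebra_simps)
          also have "\<dots> \<le> N * norm h" using yz s' by (simp add: N_def algebra_simps)
          also have "\<dots> < \<rho>" using h N by (simp add: field_simps)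
          finally have "norm (pd g b (y + s *\<^sub>R b) - pd g b z) \<le> \<epsilon>/2"
            using \<rho>(2) by (simp add: dist_norm less_imp_le)
          then show "onorm (\<lambda>r. r *\<^sub>R (pd g b (y + s *\<^sub>R b) - pd g b z)) \<le> \<epsilon>/2"
            by (intro onorm_le) (auto simp: mult.commute[of _ "\<bar>_\<bar>"] intro!: mult_left_mono simp del: times_divide_eq_right)
        qed auto
        also have "\<dots> \<le> \<epsilon>/2 * norm h" using hb[OF b] \<epsilon> by simp
        finally have 1: "norm (g (y + (h \<bullet> b) *\<^sub>R b) - g y - (h \<bullet> b) *\<^sub>R pd g b z) \<le> \<epsilon>/2 * norm h"
          by (simp add: \<phi>_def algebra_simps)
        have 2: "norm (g y - g z - (\<Sum>e\<in>B. (h \<bullet> e) *\<^sub>R pd g e z)) \<le> \<epsilon>/2 * norm h"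
          using \<delta>1(2)[of h] h by (simp add: y_def)
        have zy: "z + (\<Sum>e\<in>insert b B. (h \<bullet> e) *\<^sub>R e) = y + (h \<bullet> b) *\<^sub>R b"
          using insert by (simp add: y_def algebra_simps)
        have eq: "g (z + (\<Sum>e\<in>insert b B. (h \<bullet> e) *\<^sub>R e)) - g z - (\<Sum>e\<in>insert b B. (h \<bullet> e) *\<^sub>R pd g e z)
          = (g (y + (h \<bullet> b) *\<^sub>R b) - g y - (h \<bullet> b) *\<^sub>R pd g b z) + (g y - g z - (\<Sum>e\<in>B. (h \<bullet> e) *\<^sub>R pd g e z))"
          unfolding zy using insert.hyps by simp
        then show "norm (g (z + (\<Sum>e\<in>insert b B. (h \<bullet> e) *\<^sub>R e)) - g z -
               (\<Sum>e\<in>insert b B. (h \<bullet> e) *\<^sub>R pd g e z)) \<le> \<epsilon> * norm h"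
          unfolding eq using norm_triangle_mono[OF 1 2] by simp
      qed
    qed
  qed
  show ?thesis
    unfolding has_derivative_at_alt
  proof (intro conjI allI impI)
    show "bounded_linear (\<lambda>h. \<Sum>e\<in>Basis. (h \<bullet> e) *\<^sub>R pd g e z)"
      by (intro bounded_linear_sum bounded_linear_scaleR_const bounded_linear_inner_left)
    fix \<epsilon> :: real assume "\<epsilon> > 0"
    then obtain \<delta> where "\<delta> > 0" and \<delta>: "\<And>h. norm h < \<delta> \<Longrightarrow>
      norm (g (z + h) - g z - (\<Sum>e\<in>Basis. (h \<bullet> e) *\<^sub>R pd g e z)) \<le> \<epsilon> * norm h"
      using partial[of Basis] by (auto simp: euclidean_representation)
    then show "\<exists>d>0. \<forall>y. norm (y - z) < d \<longrightarrow>
        norm (g y - g z - (\<Sum>e\<in>Basis. ((y - z) \<bullet> e) *\<^sub>R pd g e z)) \<le> \<epsilon> * norm (y - z)"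
      by (intro exI[of _ \<delta>]) (auto dest: \<delta>[of "_ - z"])
  qed
qed

lemma C1_continuous_on: "C1 g \<Longrightarrow> continuous_on S g"
  by (meson C1_has_derivative has_derivative_continuous continuous_at_imp_continuous_on)

lemma pd_has_derivative:
  assumes "(g has_derivative g') (at z)"
  shows "pd g e z = g' e"
proof -
  have "(g \<circ> (\<lambda>h. z + h *\<^sub>R e) has_derivative g' \<circ> (\<lambda>h. h *\<^sub>R e)) (at 0)"
    using assms by (intro diff_chain_at) (auto intro!: derivative_eq_intros)
  then have "((\<lambda>h. g (z + h *\<^sub>R e)) has_vector_derivative g' e) (at 0)"
    by (simp add: has_vector_derivative_def o_def linear_simps(5)[OF has_derivative_bounded_linear[OF assms]])
  then show ?thesis unfolding pd_def by (rule vector_derivative_at)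
qed

text \<open>The passage back to partial derivatives, used to certify the explicit test functions as
  \<open>C1\<close>.\<close>

lemma C1I:
  assumes "\<And>z. (g has_derivative g' z) (at z)"
    and "\<And>e. e \<in> Basis \<Longrightarrow> continuous_on UNIV (\<lambda>z. g' z e)"
  shows "C1 g"
proof -
  have "pd g e = (\<lambda>z. g' z e)" for e
    using pd_has_derivative[OF assms(1)] by blast
  moreover have "(\<lambda>h. g (z + h *\<^sub>R e)) differentiable (at 0)" for z e
  proof -
    have "(g \<circ> (\<lambda>h. z + h *\<^sub>R e) has_derivative g' z \<circ> (\<lambda>h. h *\<^sub>R e)) (at 0)"
      using assms by (intro diff_chain_at) (auto intro!: derivative_eq_intros)
    then show ?thesis by (auto simp: differentiable_def o_def)
  qed
  ultimately show ?thesis using assms(2) by (simp add: C1_def)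
qed

section \<open>Relative entropy: quadratic lower bound and coercivity\<close>

definition grad :: "(real^'n \<Rightarrow> real) \<Rightarrow> real^'n \<Rightarrow> real^'n" where
  "grad g x = (\<chi> i. pd g (axis i 1) x)"

definition rel_entropy :: "(real^'n \<Rightarrow> real) \<Rightarrow> real^'n \<Rightarrow> real^'n \<Rightarrow> real" where
  "rel_entropy g a b = g a - g b - grad g b \<bullet> (a - b)"

lemma sum_Basis_vec:
  "(\<Sum>e\<in>(Basis :: (real^'n) set). F e) = (\<Sum>i\<in>UNIV. F (axis i 1))"
proof -
  have B: "(Basis :: (real^'n) set) = range (\<lambda>i. axis i 1)"
    by (auto simp: Basis_vec_def)
  have inj: "inj (\<lambda>i. axis i (1::real) :: real^'n)"
    by (auto simp: inj_on_def axis_eq_axis)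
  show ?thesis unfolding B using inj by (simp add: sum.reindex)
qed

lemma continuous_on_grad: "C1 g \<Longrightarrow> continuous_on S (grad g)"
  unfolding grad_def
  by (intro continuous_on_vec_lambda) (auto simp: C1_def axis_in_Basis_iff intro: continuous_on_subset[OF _ subset_UNIV])

text \<open>Second-order Taylor formula with Lagrange remainder along the segment from
  \<open>b\<close> to \<open>a\<close>: the relative entropy is half the Hessian form at an
  intermediate point.\<close>

lemma rel_entropy_ge:
  fixes g :: "real^'n \<Rightarrow> real"
  assumes "C2 g"
    and hess: "\<And>l \<xi>. (\<Sum>i\<in>UNIV. \<Sum>j\<in>UNIV. pd (pd g (axis i 1)) (axis j 1) l * \<xi> $ i * \<xi> $ j) \<ge> c * norm \<xi> ^ 2"
  shows "rel_entropy g a b \<ge> c / 2 * norm (a - b) ^ 2"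
proof -
  define \<xi> where "\<xi> = a - b"
  define H where "H s = (\<Sum>i\<in>UNIV. \<Sum>j\<in>UNIV. pd (pd g (axis i 1)) (axis j 1) (b + s *\<^sub>R \<xi>) * \<xi> $ i * \<xi> $ j)" for s
  \<comment> \<open>The restriction of \<open>g\<close> to the segment and its first two
    derivatives; the value for \<open>k > 2\<close> is a filler, since the expansion stops at order
    2.\<close>
  define D where "D k s = (if k = 0 then g (b + s *\<^sub>R \<xi>) else if k = 1 then grad g (b + s *\<^sub>R \<xi>) \<bullet> \<xi> else H s)"
    for k :: nat and s :: real
  have C1g: "C1 g" and C1p: "C1 (pd g (axis i 1))" for i
    using assms(1) by (auto simp: C2_def axis_in_Basis_iff)
  have line: "((\<lambda>s. b + s *\<^sub>R \<xi>) has_derivative (\<lambda>r. r *\<^sub>R \<xi>)) (at s)" for s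
    by (auto intro!: derivative_eq_intros)
  have chain: "((\<lambda>s. u (b + s *\<^sub>R \<xi>)) has_real_derivative (\<Sum>i\<in>UNIV. pd u (axis i 1) (b + s *\<^sub>R \<xi>) * \<xi> $ i)) (at s)"
    if "C1 u" for u :: "real^'n \<Rightarrow> real" and s
  proof -
    have "(u \<circ> (\<lambda>s. b + s *\<^sub>R \<xi>) has_derivative
        (\<lambda>h. \<Sum>e\<in>Basis. (h \<bullet> e) *\<^sub>R pd u e (b + s *\<^sub>R \<xi>)) \<circ> (\<lambda>r. r *\<^sub>R \<xi>)) (at s)"
      by (intro diff_chain_at line C1_has_derivative that)
    then show ?thesis
      unfolding has_field_derivative_def o_def
      by (rule has_derivative_eq_rhs)
         (auto simp: fun_eq_iff sum_Basis_vec inner_axis sum_distrib_left sum_distrib_right mult_ac)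
  qed
  have "\<exists>t>0. t < 1 \<and> D 0 1 = (\<Sum>m<2. D m 0 / fact m * 1 ^ m) + D 2 t / fact 2 * 1 ^ 2"
  proof (rule Maclaurin)
    show "\<forall>m t. m < 2 \<and> 0 \<le> t \<and> t \<le> 1 \<longrightarrow> DERIV (D m) t :> D (Suc m) t"
    proof (intro allI impI)
      fix m :: nat and t :: real assume m: "m < 2 \<and> 0 \<le> t \<and> t \<le> 1"
      have 0: "DERIV (D 0) t :> D (Suc 0) t"
        using chain[OF C1g, of t] by (simp add: D_def[abs_def] grad_def inner_vec_def)
      have "((\<lambda>s. \<Sum>i\<in>UNIV. pd g (axis i 1) (b + s *\<^sub>R \<xi>) * \<xi> $ i) has_real_derivative
         (\<Sum>i\<in>UNIV. (\<Sum>j\<in>UNIV. pd (pd g (axis i 1)) (axis j 1) (b + t *\<^sub>R \<xi>) * \<xi> $ j) * \<xi> $ i)) (at t)"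
        by (auto intro!: derivative_eq_intros chain C1p)
      then have 1: "DERIV (D 1) t :> D (Suc 1) t"
        by (simp add: D_def[abs_def] H_def grad_def inner_vec_def sum_distrib_right sum_distrib_left mult_ac)
      show "DERIV (D m) t :> D (Suc m) t"
        using m 0 1 by (cases m; cases "m - 1") auto
    qed
  qed auto
  then obtain t where "D 0 1 = (\<Sum>m<2. D m 0 / fact m) + D 2 t / 2"
    by (auto simp: fact_numeral)
  then have "D 0 1 = D 0 0 + D 1 0 + D 2 t / 2" by (simp add: numeral_2_eq_2)
  then have "g (b + \<xi>) = g b + grad g b \<bullet> \<xi> + H t / 2" by (simp add: D_def)
  moreover have "H t \<ge> c * norm \<xi> ^ 2" unfolding H_def by (rule hess)
  ultimately show ?thesis by (simp add: rel_entropy_def \<xi>_def)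
qed

text \<open>There are two regimes of |a - b|. Up to a threshold \<open>L\<close> the quadratic bound
  suffices, since a p-th power is then at most \<open>L powr (p - 2)\<close> times a square. Beyond
  it the growth of \<open>g\<close> at \<open>a\<close> beats the affine part taken at
  \<open>b\<close>, whose coefficients are bounded because \<open>b\<close> stays in a ball; this is
  how \<open>K\<close> comes to depend on \<open>R\<close>.\<close>

lemma rel_entropy_coercive:
  fixes g :: "real^'n \<Rightarrow> real"
  assumes g: "C1 g" and "c > 0" "\<alpha> > 0" "p \<ge> 2"
    and quad: "\<And>a b. rel_entropy g a b \<ge> c * norm (a - b) ^ 2"
    and low: "\<And>a. \<alpha> * norm a powr p - A \<le> g a"
  shows "\<exists>K>0. \<forall>a b. norm b \<le> R \<longrightarrow> norm (a - b) powr p \<le> K * rel_entropy g a b"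
proof -
  have bdd: "\<exists>M>0. \<forall>b. norm b \<le> R \<longrightarrow> norm (u b) \<le> M"
    if "continuous_on UNIV u" for u :: "real^'n \<Rightarrow> 'z::real_normed_vector"
  proof -
    have "compact (u ` cball 0 R)"
      using that by (intro compact_continuous_image compact_cball) (auto intro: continuous_on_subset)
    then obtain M where "M > 0" "\<forall>x\<in>u ` cball 0 R. norm x \<le> M"
      using compact_imp_bounded bounded_pos by metis
    then show ?thesis by (intro exI[of _ M]) auto
  qed
  obtain M1 where M1: "M1 > 0" "\<And>b. norm b \<le> R \<Longrightarrow> norm (g b) \<le> M1"
    using bdd[OF C1_continuous_on[OF g]] by auto
  obtain M2 where M2: "M2 > 0" "\<And>b. norm b \<le> R \<Longrightarrow> norm (grad g b) \<le> M2"
    using bdd[OF continuous_on_grad[OF g]] by auto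
  \<comment> \<open>The factor \<open>(1/2) powr p\<close> is the price of |a| >= |a - b| / 2, which
    holds once |a - b| >= 2 R.\<close>
  define k where "k = \<alpha> * (1/2) powr p"
  \<comment> \<open>The entry 1 lets constants be absorbed into multiples of \<open>y\<close>, and a
    square into \<open>y powr p\<close>; \<open>2 * R\<close> gives |a| >= y / 2; the last entry
    makes the affine part at most half of \<open>k * y powr p\<close>.\<close>
  define L where "L = max (max 1 (2 * R)) (2 * (\<bar>A\<bar> + M1 + M2) / k)"
  have k: "k > 0" using assms by (simp add: k_def)
  have L: "L \<ge> 1" "L \<ge> 2 * R" "L * k \<ge> 2 * (\<bar>A\<bar> + M1 + M2)"
  proof -
    have "L \<ge> 2 * (\<bar>A\<bar> + M1 + M2) / k" by (simp add: L_def)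
    then show "L * k \<ge> 2 * (\<bar>A\<bar> + M1 + M2)" using k by (simp add: field_simps)
  qed (auto simp: L_def)
  define K where "K = L powr (p - 2) / c + 2 / k"
  have K: "K > 0" using assms k L by (auto simp: K_def intro!: add_nonneg_pos)
  show ?thesis
  proof (intro exI[of _ K] conjI K allI impI)
    fix a b :: "real^'n" assume b: "norm b \<le> R"
    define y where "y = norm (a - b)"
    define E where "E = rel_entropy g a b"
    have E: "E \<ge> c * y^2" using quad by (simp add: E_def y_def)
    have E0: "E \<ge> 0" using E \<open>c > 0\<close> by (smt (verit) mult_nonneg_nonneg zero_le_power2)
    show "norm (a - b) powr p \<le> K * rel_entropy g a b"
    proof (cases "y \<le> L")
      case True
      have "y powr p = y powr (p - 2) * y^2"
        using powr_add[of y "p - 2" 2] by (cases "y = 0") (auto simp: y_def)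
      also have "\<dots> \<le> L powr (p - 2) * y^2"
        using True assms by (intro mult_right_mono powr_mono2) (auto simp: y_def)
      also have "\<dots> \<le> L powr (p - 2) * (E / c)"
        using E \<open>c > 0\<close> by (intro mult_left_mono) (auto simp: field_simps)
      also have "\<dots> \<le> K * E" using E0 k by (simp add: K_def algebra_simps)
      finally show ?thesis by (simp add: y_def E_def)
    next
      case False
      have y1: "y \<ge> 1" "y > 0" using False L by auto
      have "norm a \<ge> y - R" using norm_triangle_ineq4[of a b] b by (simp add: y_def)
      then have "norm a \<ge> y / 2" using False L by simp
      then have "\<alpha> * (y / 2) powr p \<le> \<alpha> * norm a powr p"
        using assms y1 by (intro mult_left_mono powr_mono2) auto
      moreover have "k * y powr p = \<alpha> * (y / 2) powr p"
        using y1 by (simp add: k_def powr_divide)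
      ultimately have ga: "k * y powr p - A \<le> g a"
        using low[of a] by linarith
      have "grad g b \<bullet> (a - b) \<le> M2 * y"
        using norm_cauchy_schwarz[of "grad g b" "a - b"] M2(2)[OF b] 
        by (smt (verit) mult_right_mono norm_ge_zero y_def)
      then have "E \<ge> k * y powr p - \<bar>A\<bar> - M1 - M2 * y"
        using ga M1(2)[OF b] by (simp add: E_def rel_entropy_def)
      moreover have "\<bar>A\<bar> + M1 + M2 * y \<le> (\<bar>A\<bar> + M1 + M2) * y"
      proof -
        have "\<bar>A\<bar> \<le> \<bar>A\<bar> * y" "M1 \<le> M1 * y" using y1 M1(1) by (auto simp: mult_le_cancel_left1)
        then show ?thesis by (simp add: algebra_simps)
      qed
      moreover have "(\<bar>A\<bar> + M1 + M2) * y \<le> (y * k / 2) * y"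
        using L(3) False k y1 by (intro mult_right_mono) (smt (verit) mult_right_mono field_sum_of_halves)+
      moreover have "k / 2 * (y * y) \<le> k / 2 * y powr p"
      proof -
        have "y powr 2 \<le> y powr p" using y1 assms by (intro powr_mono) auto
        then show ?thesis using k y1 by (simp add: power2_eq_square)
      qed
      ultimately have "E \<ge> k / 2 * y powr p" by (simp add: algebra_simps)
      then have "y powr p \<le> 2 / k * E" using k by (simp add: field_simps)
      also have "\<dots> \<le> K * E" using E0 \<open>c > 0\<close> by (simp add: K_def algebra_simps)
      finally show ?thesis by (simp add: y_def E_def)
    qed
  qed
qed

section \<open>From weak to strong convergence\<close>

lemma powr_norm_diff_le:
  fixes a b c :: "'a::real_normed_vector"
  assumes "p \<ge> 0"
  shows "norm (a - b) powr p \<le> 2 powr p * (norm (a - c) powr p + norm (b - c) powr p)"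
proof -
  define m where "m = max (norm (a - c)) (norm (b - c))"
  have "norm (a - b) \<le> norm (a - c) + norm (b - c)"
    using dist_triangle2[of a b c] by (simp add: dist_norm)
  then have "norm (a - b) \<le> 2 * m" by (simp add: m_def)
  then have "norm (a - b) powr p \<le> (2 * m) powr p"
    using assms by (intro powr_mono2) auto
  also have "\<dots> = 2 powr p * m powr p"
    by (simp add: powr_mult m_def)
  also have "m powr p \<le> norm (a - c) powr p + norm (b - c) powr p"
    by (simp add: m_def max_def)
  finally show ?thesis by simp
qed

lemma le_one_plus_powr:
  fixes y p :: real
  assumes "0 \<le> y" "1 \<le> q" "q \<le> p"
  shows "y powr q \<le> 1 + y powr p"
proof (cases "y \<le> 1")
  case True
  then have "y powr q \<le> 1 powr q" using assms by (intro powr_mono2) auto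
  then show ?thesis by (simp add: add_increasing2)
next
  case False
  then have "y powr q \<le> y powr p" using assms by (intro powr_mono) auto
  then show ?thesis by simp
qed

lemma square_le_one_plus_powr:
  fixes y p :: real
  assumes "0 \<le> y" "2 \<le> p"
  shows "y^2 \<le> 1 + y powr p"
  using le_one_plus_powr[of y 2 p] assms by (cases "y = 0") auto

lemma abs_le_one_plus_square: "\<bar>y\<bar> \<le> 1 + y\<^sup>2" for y :: real
proof -
  have "(\<bar>y\<bar> - 1)\<^sup>2 = y\<^sup>2 - 2 * \<bar>y\<bar> + 1" by (simp add: power2_diff)
  then show ?thesis using zero_le_power2[of "\<bar>y\<bar> - 1"] zero_le_power2[of y] by linarith
qed

text \<open>The \<open>h k\<close> are uniformly bounded on a finite measure space, so their a.e.
  convergence is L2 convergence. Paired with a family bounded in L2, this makes the error of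
  replacing \<open>g\<close> by \<open>h k\<close> small uniformly in \<tau>: a single
  \<open>k\<close> serves all \<tau>, and only then is the limit along \<open>F\<close>
  taken.\<close>

lemma (in finite_measure) weak_closure:
  fixes u :: "'t \<Rightarrow> 'a \<Rightarrow> real" and h :: "nat \<Rightarrow> 'a \<Rightarrow> real"
  assumes u: "\<forall>\<^sub>F \<tau> in F. u \<tau> \<in> borel_measurable M \<and> integrable M (\<lambda>x. (u \<tau> x)^2) \<and> (\<integral>x. (u \<tau> x)^2 \<partial>M) \<le> K"
    and h: "\<And>k. h k \<in> borel_measurable M" "\<And>k x. x \<in> space M \<Longrightarrow> \<bar>h k x\<bar> \<le> 1"
    and g: "g \<in> borel_measurable M" "\<And>x. x \<in> space M \<Longrightarrow> \<bar>g x\<bar> \<le> 1"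
    and conv: "AE x in M. (\<lambda>k. h k x) \<longlonglongrightarrow> g x"
    and lim: "\<And>k. ((\<lambda>\<tau>. \<integral>x. h k x * u \<tau> x \<partial>M) \<longlongrightarrow> 0) F"
  shows "((\<lambda>\<tau>. \<integral>x. g x * u \<tau> x \<partial>M) \<longlongrightarrow> 0) F"
proof (rule tendstoI)
  fix \<epsilon> :: real assume \<epsilon>: "\<epsilon> > 0"
  define K' where "K' = \<bar>K\<bar> + 1"
  have K': "K' > 0" "K \<le> K'" by (auto simp: K'_def)
  \<comment> \<open>Weight in a b <= a^2 / (2 c) + c b^2 / 2. It makes the second term at most
    \<open>\<epsilon> / 4\<close>, and \<open>k\<close> is then chosen to do the same for the first.
    The 1 added in \<open>K'\<close> keeps the divisor positive.\<close>
  define c where "c = \<epsilon> / (2 * K')"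
  have c: "c > 0" using \<epsilon> K' by (simp add: c_def)
  have bnd: "(h k x - g x)^2 \<le> 4" if "x \<in> space M" for k x
  proof -
    have "\<bar>h k x - g x\<bar> \<le> 2" using h(2)[OF that, of k] g(2)[OF that] by linarith
    then have "\<bar>h k x - g x\<bar>^2 \<le> 2^2" by (intro power_mono) auto
    then show ?thesis by simp
  qed
  have int_sq: "integrable M (\<lambda>x. (h k x - g x)^2)" for k
    by (rule integrable_const_bound[where B=4]) (use h g bnd in auto)
  have "(\<lambda>k. \<integral>x. (h k x - g x)^2 \<partial>M) \<longlonglongrightarrow> (\<integral>x. 0 \<partial>M)"
  proof (rule integral_dominated_convergence[where w="\<lambda>_. 4"])
    show "AE x in M. (\<lambda>k. (h k x - g x)\<^sup>2) \<longlonglongrightarrow> 0"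
      using conv
    proof eventually_elim
      case (elim x)
      then have "(\<lambda>k. (h k x - g x)^2) \<longlonglongrightarrow> (g x - g x)^2" by (intro tendsto_intros)
      then show ?case by simp
    qed
  qed (use h g bnd in auto)
  then have "\<forall>\<^sub>F k in sequentially. (\<integral>x. (h k x - g x)^2 \<partial>M) < c * \<epsilon> / 2"
    using c \<epsilon> by (intro order_tendstoD) auto
  then obtain k where k: "(\<integral>x. (h k x - g x)^2 \<partial>M) < c * \<epsilon> / 2"
    by (auto simp: eventually_sequentially)
  have "\<forall>\<^sub>F \<tau> in F. dist (\<integral>x. h k x * u \<tau> x \<partial>M) 0 < \<epsilon> / 2"
    using tendstoD[OF lim, of "\<epsilon>/2" k] \<epsilon> by simp
  with u show "\<forall>\<^sub>F \<tau> in F. dist (\<integral>x. g x * u \<tau> x \<partial>M) 0 < \<epsilon>"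
  proof eventually_elim
    case (elim \<tau>)
    have um[measurable]: "u \<tau> \<in> borel_measurable M" and u2: "integrable M (\<lambda>x. (u \<tau> x)^2)"
      and uK: "(\<integral>x. (u \<tau> x)^2 \<partial>M) \<le> K"
      using elim by auto
    have prod: "integrable M (\<lambda>x. q x * u \<tau> x)"
      if q: "q \<in> borel_measurable M" "\<And>x. x \<in> space M \<Longrightarrow> \<bar>q x\<bar> \<le> 1" for q
    proof (rule Bochner_Integration.integrable_bound[where f="\<lambda>x. 1 + (u \<tau> x)^2"])
      show "AE x in M. norm (q x * u \<tau> x) \<le> norm (1 + (u \<tau> x)\<^sup>2)"
      proof (rule AE_I2)
        fix x assume "x \<in> space M"
        then have "\<bar>q x\<bar> * \<bar>u \<tau> x\<bar> \<le> 1 * \<bar>u \<tau> x\<bar>" using q(2) by (intro mult_right_mono) auto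
        also have "\<dots> \<le> 1 + (u \<tau> x)^2"
          using abs_le_one_plus_square by simp
        finally show "norm (q x * u \<tau> x) \<le> norm (1 + (u \<tau> x)\<^sup>2)" by (simp add: abs_mult)
      qed
      show "(\<lambda>x. q x * u \<tau> x) \<in> borel_measurable M" using q(1) by measurable
    qed (use u2 in auto)
    have ih: "integrable M (\<lambda>x. h k x * u \<tau> x)" and ig: "integrable M (\<lambda>x. g x * u \<tau> x)"
      using prod h g by auto
    have "\<bar>(\<integral>x. g x * u \<tau> x \<partial>M) - (\<integral>x. h k x * u \<tau> x \<partial>M)\<bar> = \<bar>\<integral>x. (g x - h k x) * u \<tau> x \<partial>M\<bar>"
      using ih ig by (simp add: left_diff_distrib)
    also have "\<dots> \<le> (\<integral>x. (h k x - g x)^2 / (2 * c) + c / 2 * (u \<tau> x)^2 \<partial>M)"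
    proof (intro order_trans[OF integral_abs_bound] integral_mono)
      show "integrable M (\<lambda>x. \<bar>(g x - h k x) * u \<tau> x\<bar>)" using ih ig by (simp add: left_diff_distrib)
      show "integrable M (\<lambda>x. (h k x - g x)^2 / (2 * c) + c / 2 * (u \<tau> x)^2)" using int_sq u2 by auto
      fix x
      define a b where "a = \<bar>g x - h k x\<bar>" and "b = \<bar>u \<tau> x\<bar>"
      have "0 \<le> (a - c * b)^2 / (2 * c)" using c by simp
      also have "\<dots> = a^2 / (2 * c) + c / 2 * b^2 - a * b"
        using c by (simp add: field_simps power2_eq_square)
      finally have "a * b \<le> a^2 / (2 * c) + c / 2 * b^2" by simp
      then show "\<bar>(g x - h k x) * u \<tau> x\<bar> \<le> (h k x - g x)^2 / (2 * c) + c / 2 * (u \<tau> x)^2"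
        by (simp add: a_def b_def abs_mult power2_commute[of "h k x"])
    qed
    also have "\<dots> = (\<integral>x. (h k x - g x)^2 \<partial>M) / (2 * c) + c / 2 * (\<integral>x. (u \<tau> x)^2 \<partial>M)"
      using int_sq u2 by simp
    also have "\<dots> \<le> (c * \<epsilon> / 2) / (2 * c) + c / 2 * K'"
      using k c uK K' by (intro add_mono divide_right_mono mult_left_mono) auto
    also have "\<dots> = \<epsilon> / 2" using c K' by (simp add: c_def field_simps)
    finally show ?case using elim(2) unfolding dist_real_def by linarith
  qed
qed

text \<open>Lower orthants are an intersection-stable generator of the Borel sets. Good sets are
  closed under complements by \<open>whole\<close>; for a disjoint union the finite partial unions
  are good by additivity, and \<open>weak_closure\<close> passes to the limit.\<close>

lemma weak_convergence_borel:
  fixes u :: "'t \<Rightarrow> (real^'d) \<Rightarrow> real"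
  assumes fin: "finite_measure M"
    and [measurable]: "(\<lambda>x. x) \<in> borel_measurable M"
    and u: "\<forall>\<^sub>F \<tau> in F. u \<tau> \<in> borel_measurable M \<and> integrable M (\<lambda>x. (u \<tau> x)^2) \<and> (\<integral>x. (u \<tau> x)^2 \<partial>M) \<le> K"
    and whole: "((\<lambda>\<tau>. \<integral>x. u \<tau> x \<partial>M) \<longlongrightarrow> 0) F"
    and boxes: "\<And>a. ((\<lambda>\<tau>. \<integral>x. indicator {..a} x * u \<tau> x \<partial>M) \<longlongrightarrow> 0) F"
    and "B \<in> sets borel"
  shows "((\<lambda>\<tau>. \<integral>x. indicator B x * u \<tau> x \<partial>M) \<longlongrightarrow> 0) F"
proof -
  interpret finite_measure M by fact
  have ind: "(indicator B :: _ \<Rightarrow> real) \<in> borel_measurable M" if "B \<in> sets borel" for B :: "(real^'d) set"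
    using measurable_compose[OF assms(2) borel_measurable_indicator[OF that]] by simp
  have int_u: "\<forall>\<^sub>F \<tau> in F. integrable M (u \<tau>) \<and> (\<forall>B\<in>sets borel. integrable M (\<lambda>x. indicator B x * u \<tau> x))"
    using u
  proof eventually_elim
    case (elim \<tau>)
    have "integrable M (u \<tau>)"
    proof (rule Bochner_Integration.integrable_bound[where f="\<lambda>x. 1 + (u \<tau> x)^2"])
      show "AE x in M. norm (u \<tau> x) \<le> norm (1 + (u \<tau> x)\<^sup>2)"
      proof (rule AE_I2)
        fix x 
        show "norm (u \<tau> x) \<le> norm (1 + (u \<tau> x)\<^sup>2)"
          using abs_le_one_plus_square by simp
      qed
    qed (use elim in auto)
    moreover have "integrable M (\<lambda>x. indicator B x * u \<tau> x)" if "B \<in> sets borel" for B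
      by (rule Bochner_Integration.integrable_bound[OF \<open>integrable M (u \<tau>)\<close>])
         (use ind[OF that] elim in \<open>auto simp: abs_mult mult_left_le_one_le intro!: borel_measurable_times\<close>)
    ultimately show ?case by auto
  qed
  have gen: "sets (borel :: (real^'d) measure) = sigma_sets UNIV (range (\<lambda>a. {..a}))"
    by (subst borel_eq_atMost) simp
  have "Int_stable (range (\<lambda>a::real^'d. {..a}))"
    unfolding Int_stable_def
  proof safe
    fix a b :: "real^'d"
    have "{..a} \<inter> {..b} = {..inf a b}" by (auto simp: le_inf_iff)
    then show "{..a} \<inter> {..b} \<in> range atMost" by blast
  qed
  moreover have "range (\<lambda>a::real^'d. {..a}) \<subseteq> Pow UNIV" by simp
  ultimately show ?thesis
    using \<open>B \<in> sets borel\<close>[unfolded gen]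
  proof (induction B rule: sigma_sets_induct_disjoint)
    case (basic A)
    then show ?case using boxes by auto
  next
    case empty
    then show ?case by simp
  next
    case (compl A)
    have A: "A \<in> sets borel" using compl by (simp add: gen)
    have "((\<lambda>\<tau>. (\<integral>x. u \<tau> x \<partial>M) - (\<integral>x. indicator A x * u \<tau> x \<partial>M)) \<longlongrightarrow> 0 - 0) F"
      by (intro tendsto_diff whole compl)
    moreover have "\<forall>\<^sub>F \<tau> in F. (\<integral>x. u \<tau> x \<partial>M) - (\<integral>x. indicator A x * u \<tau> x \<partial>M)
        = (\<integral>x. indicator (UNIV - A) x * u \<tau> x \<partial>M)"
      using int_u
    proof eventually_elim
      case (elim \<tau>)
      then have "(\<integral>x. u \<tau> x \<partial>M) - (\<integral>x. indicator A x * u \<tau> x \<partial>M) = (\<integral>x. u \<tau> x - indicator A x * u \<tau> x \<partial>M)"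
        using A by simp
      also have "\<dots> = (\<integral>x. indicator (UNIV - A) x * u \<tau> x \<partial>M)"
        by (intro Bochner_Integration.integral_cong) (auto simp: indicator_def)
      finally show ?case .
    qed
    ultimately show ?case by (simp add: tendsto_cong)
  next
    case (union A)
    have A: "A i \<in> sets borel" for i using union by (auto simp: gen)
    show ?case
    proof (rule weak_closure[OF u])
      fix k
      have "((\<lambda>\<tau>. \<Sum>i<k. \<integral>x. indicator (A i) x * u \<tau> x \<partial>M) \<longlongrightarrow> (\<Sum>i<k. 0)) F"
        by (intro tendsto_sum union)
      moreover have "\<forall>\<^sub>F \<tau> in F. (\<Sum>i<k. \<integral>x. indicator (A i) x * u \<tau> x \<partial>M)
          = (\<integral>x. indicator (\<Union>i<k. A i) x * u \<tau> x \<partial>M)"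
        using int_u
      proof eventually_elim
        case (elim \<tau>)
        have "disjoint_family_on A {..<k}" using union(1) by (auto simp: disjoint_family_on_def)
        then have ind_sum: "(indicator (\<Union>i<k. A i) x :: real) = (\<Sum>i<k. indicator (A i) x)" for x
          by (simp add: indicator_UN_disjoint)
        show ?case unfolding ind_sum sum_distrib_right
          using elim A by (subst Bochner_Integration.integral_sum) auto
      qed
      ultimately show "((\<lambda>\<tau>. \<integral>x. indicator (\<Union>i<k. A i) x * u \<tau> x \<partial>M) \<longlongrightarrow> 0) F"
        by (simp add: tendsto_cong)
    next
      show "AE x in M. (\<lambda>k. indicator (\<Union>i<k. A i) x) \<longlonglongrightarrow> (indicator (\<Union>i. A i) x :: real)"
        by (intro AE_I2 LIMSEQ_indicator_UN)
    next
      fix k show "(indicator (\<Union>i<k. A i) :: _ \<Rightarrow> real) \<in> borel_measurable M"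
        using A by (intro ind) auto
    next
      show "(indicator (\<Union>i. A i) :: _ \<Rightarrow> real) \<in> borel_measurable M" using A by (intro ind) auto
    qed (auto simp: indicator_def)
  qed
qed

text \<open>The passage from weak to strong convergence sees the entropy only through these
  pointwise facts; the Hessian bound is spent on the two statements about
  \<open>rel_entropy\<close>.\<close>

locale entropy_function =
  fixes g :: "real^'n \<Rightarrow> real" and \<alpha> A p :: real
  assumes C1: "C1 g"
    and rel_entropy_nonneg: "\<And>a b. rel_entropy g a b \<ge> 0"
    and rel_entropy_coercive: "\<And>R. \<exists>K>0. \<forall>a b. norm b \<le> R \<longrightarrow> norm (a - b) powr p \<le> K * rel_entropy g a b"
    and lower: "\<And>a. \<alpha> * norm a powr p - A \<le> g a"
    and \<alpha>_pos: "\<alpha> > 0"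
    and p_ge_2: "p \<ge> 2"
begin

lemma continuous_rel_entropy: "continuous_on UNIV (\<lambda>z. rel_entropy g (fst z) (snd z))"
proof -
  note c = continuous_on_compose2[OF C1_continuous_on[OF C1] _ subset_UNIV]
    continuous_on_compose2[OF continuous_on_grad[OF C1] _ subset_UNIV]
  show ?thesis unfolding rel_entropy_def by (intro continuous_intros c)
qed

lemma measurable_g [measurable]: "g \<in> borel_measurable borel"
  and measurable_grad [measurable]: "grad g \<in> borel_measurable borel"
  using C1_continuous_on[OF C1] continuous_on_grad[OF C1]
  by (auto intro: borel_measurable_continuous_onI)

lemma measurable_rel_entropy [measurable]:
  assumes [measurable]: "a \<in> borel_measurable M" "b \<in> borel_measurable M"
  shows "(\<lambda>x. rel_entropy g (a x) (b x)) \<in> borel_measurable M"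
  unfolding rel_entropy_def by measurable

lemma powr_le: "norm a powr p \<le> (g a + A) / \<alpha>"
  using lower[of a] \<alpha>_pos by (simp add: field_simps)

lemma norm_le: "norm a \<le> 1 + (g a + A) / \<alpha>"
  using le_one_plus_powr[of "norm a" 1 p] powr_le[of a] p_ge_2 by simp

lemma square_norm_le: "(norm a)^2 \<le> 1 + (g a + A) / \<alpha>"
  using square_le_one_plus_powr[of "norm a" p] powr_le[of a] p_ge_2 by simp

lemma integrable_of_entropy:
  assumes "finite_measure M" and [measurable]: "a \<in> borel_measurable M"
    and int: "integrable M (\<lambda>x. g (a x))"
  shows "integrable M a" "integrable M (\<lambda>x. norm (a x) powr p)" "integrable M (\<lambda>x. (norm (a x))^2)"
proof -
  interpret finite_measure M by fact
  have dom: "integrable M (\<lambda>x. 1 + (g (a x) + A) / \<alpha>)" "integrable M (\<lambda>x. (g (a x) + A) / \<alpha>)"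
    using int by auto
  show "integrable M a"
    by (rule Bochner_Integration.integrable_bound[OF dom(1)])
       (auto intro!: AE_I2 order_trans[OF norm_le] abs_ge_self)
  show "integrable M (\<lambda>x. norm (a x) powr p)"
    by (rule Bochner_Integration.integrable_bound[OF dom(2)])
       (auto intro!: AE_I2 order_trans[OF powr_le] simp del: abs_divide)
  show "integrable M (\<lambda>x. (norm (a x))^2)"
    by (rule Bochner_Integration.integrable_bound[OF dom(1)])
       (auto intro!: AE_I2 order_trans[OF square_norm_le] abs_ge_self)
qed

lemma simple_function_bounded:
  assumes "simple_function M s"
  shows "\<exists>c. \<forall>x\<in>space M. norm (s x) \<le> (c::real)"
proof -
  have "finite (s ` space M)" using assms by (rule simple_functionD)
  then have "bounded (s ` space M)" by (rule finite_imp_bounded)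
  then show ?thesis by (auto simp: bounded_iff)
qed

lemma locally_bounded: "\<exists>c1 c2. \<forall>b. norm b \<le> c \<longrightarrow> \<bar>g b\<bar> \<le> c1 \<and> norm (grad g b) \<le> c2"
proof -
  have "bounded (g ` cball 0 c)" "bounded (grad g ` cball 0 c)"
    using C1_continuous_on[OF C1, of "cball 0 c"] continuous_on_grad[OF C1, of "cball 0 c"]
    by (auto intro!: compact_imp_bounded compact_continuous_image)
  then obtain c1 c2 where "\<forall>y\<in>g ` cball 0 c. norm y \<le> c1" "\<forall>y\<in>grad g ` cball 0 c. norm y \<le> c2"
    unfolding bounded_iff by blast
  then show ?thesis by (intro exI[of _ c1] exI[of _ c2]) auto
qed

text \<open>A bounded comparison function keeps \<open>g (s x)\<close> and
  \<open>grad g (s x)\<close> bounded, so the linear term grows at most like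
  \<open>norm (a x)\<close>, whose integrability follows from that of the entropy.\<close>

lemma integrable_rel_entropy_bounded:
  assumes fin: "finite_measure M" and [measurable]: "a \<in> borel_measurable M" "s \<in> borel_measurable M"
    and int: "integrable M (\<lambda>x. g (a x))" and bdd: "\<And>x. x \<in> space M \<Longrightarrow> norm (s x) \<le> c"
  shows "integrable M (\<lambda>x. g (s x))" "integrable M (\<lambda>x. grad g (s x) \<bullet> (a x - s x))"
    "integrable M (\<lambda>x. rel_entropy g (a x) (s x))"
proof -
  interpret finite_measure M by fact
  obtain c1 c2 where c1: "\<And>b. norm b \<le> c \<Longrightarrow> \<bar>g b\<bar> \<le> c1" and c2: "\<And>b. norm b \<le> c \<Longrightarrow> norm (grad g b) \<le> c2"
    using locally_bounded[of "c"] by blast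
  have ia: "integrable M a" by (rule integrable_of_entropy(1)[OF fin _ int]) measurable
  show 1: "integrable M (\<lambda>x. g (s x))"
    by (rule integrable_const_bound[where B=c1]) (auto intro!: AE_I2 c1 bdd)
  show 2: "integrable M (\<lambda>x. grad g (s x) \<bullet> (a x - s x))"
  proof (rule Bochner_Integration.integrable_bound[where f="\<lambda>x. c2 * (norm (a x) + c)"])
    show "integrable M (\<lambda>x. c2 * (norm (a x) + c))" using ia by auto
    show "AE x in M. norm (grad g (s x) \<bullet> (a x - s x)) \<le> norm (c2 * (norm (a x) + c))"
    proof (rule AE_I2)
      fix x assume x: "x \<in> space M"
      have "\<bar>grad g (s x) \<bullet> (a x - s x)\<bar> \<le> norm (grad g (s x)) * norm (a x - s x)"
        by (rule Cauchy_Schwarz_ineq2)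
      also have "\<dots> \<le> c2 * (norm (a x) + c)"
        using c2[OF bdd[OF x]] bdd[OF x] norm_triangle_ineq4[of "a x" "s x"] norm_ge_zero[of "grad g (s x)"]
          norm_ge_zero[of "a x - s x"]
        by (intro mult_mono) linarith+
      finally show "norm (grad g (s x) \<bullet> (a x - s x)) \<le> norm (c2 * (norm (a x) + c))" by simp
    qed
  qed measurable
  show "integrable M (\<lambda>x. rel_entropy g (a x) (s x))"
    unfolding rel_entropy_def using int 1 2 by auto
qed

text \<open>Two stages: \<open>a\<close> is truncated, then the truncation is approximated by simple
  functions. The two side conditions prepare the split in \<open>Lp_convergence\<close>: the bound
  by \<open>2 * norm (a x)\<close> keeps \<open>s\<close> in a fixed ball wherever \<open>a\<close>
  is bounded, and the vanishing beyond \<open>R\<close> makes the comparison there one with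
  0.\<close>

lemma simple_approximation:
  assumes fin: "finite_measure M" and [measurable]: "a \<in> borel_measurable M"
    and int: "integrable M (\<lambda>x. g (a x))" and "\<delta> > 0"
  shows "\<exists>R s. simple_function M s \<and> (\<forall>x\<in>space M. norm (s x) \<le> 2 * norm (a x))
      \<and> (\<forall>x\<in>space M. norm (a x) > R \<longrightarrow> s x = 0) \<and> (\<integral>x. rel_entropy g (a x) (s x) \<partial>M) < \<delta>"
proof -
  interpret finite_measure M by fact
  \<comment> \<open>Truncating to 0, rather than projecting onto the ball, makes the relative
    entropy either 0 or \<open>rel_entropy g (a x) 0\<close>, so that the latter dominates.\<close>
  define u where "u n x = (if norm (a x) \<le> real n then a x else 0)" for n x
  have [measurable]: "u n \<in> borel_measurable M" for n unfolding u_def by measurable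
  have E_self: "rel_entropy g b b = 0" for b by (simp add: rel_entropy_def)
  have ia0: "integrable M (\<lambda>x. rel_entropy g (a x) 0)"
    using integrable_rel_entropy_bounded(3)[OF fin _ _ int, of "\<lambda>_. 0" 0] by simp
  have "(\<lambda>n. \<integral>x. rel_entropy g (a x) (u n x) \<partial>M) \<longlonglongrightarrow> (\<integral>x. 0 \<partial>M)"
  proof (rule integral_dominated_convergence[where w="\<lambda>x. rel_entropy g (a x) 0"])
    show "AE x in M. (\<lambda>n. rel_entropy g (a x) (u n x)) \<longlonglongrightarrow> 0"
    proof (rule AE_I2)
      fix x
      have "\<forall>\<^sub>F n in sequentially. rel_entropy g (a x) (u n x) = 0"
        using eventually_ge_at_top[of "nat \<lceil>norm (a x)\<rceil>"]
      proof eventually_elim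
        case (elim n)
        then have "norm (a x) \<le> real n" by linarith
        then show ?case by (simp add: u_def E_self)
      qed
      then show "(\<lambda>n. rel_entropy g (a x) (u n x)) \<longlonglongrightarrow> 0" by (rule tendsto_eventually)
    qed
  qed (use ia0 rel_entropy_nonneg in \<open>auto simp: u_def E_self\<close>)
  then have "\<forall>\<^sub>F n in sequentially. (\<integral>x. rel_entropy g (a x) (u n x) \<partial>M) < \<delta>"
    using \<open>\<delta> > 0\<close> by (intro order_tendstoD) auto
  then obtain n where n: "(\<integral>x. rel_entropy g (a x) (u n x) \<partial>M) < \<delta>"
    by (auto simp: eventually_sequentially)
  \<comment> \<open>The bound by twice the norm of \<open>u n x\<close> forces the approximants to
    vanish wherever the truncation does.\<close>
  obtain s where s: "\<And>k. simple_function M (s k)" "\<And>x. x \<in> space M \<Longrightarrow> (\<lambda>k. s k x) \<longlonglongrightarrow> u n x"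
    "\<And>k x. x \<in> space M \<Longrightarrow> norm (s k x) \<le> 2 * norm (u n x)"
    using borel_measurable_implies_sequence_metric[of "u n" M 0] unfolding dist_0_norm dist_commute[of _ 0]
    by (metis \<open>u n \<in> borel_measurable M\<close>)
  have [measurable]: "s k \<in> borel_measurable M" for k using s(1) by (rule borel_measurable_simple_function)
  have un: "norm (u n x) \<le> norm (a x)" "norm (u n x) \<le> real n" for x by (auto simp: u_def)
  have sb: "norm (s k x) \<le> 2 * real n" if "x \<in> space M" for k x
    using s(3)[OF that, of k] un(2)[of x] by linarith
  obtain c1 c2 where c1: "\<And>b. norm b \<le> 2 * real n \<Longrightarrow> \<bar>g b\<bar> \<le> c1"
    and c2: "\<And>b. norm b \<le> 2 * real n \<Longrightarrow> norm (grad g b) \<le> c2"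
    using locally_bounded[of "2 * real n"] by blast
  have ia: "integrable M a" by (rule integrable_of_entropy(1)[OF fin _ int]) measurable
  have "(\<lambda>k. \<integral>x. rel_entropy g (a x) (s k x) \<partial>M) \<longlonglongrightarrow> (\<integral>x. rel_entropy g (a x) (u n x) \<partial>M)"
  proof (rule integral_dominated_convergence[where w="\<lambda>x. \<bar>g (a x)\<bar> + c1 + c2 * (norm (a x) + 2 * real n)"])
    show "integrable M (\<lambda>x. \<bar>g (a x)\<bar> + c1 + c2 * (norm (a x) + 2 * real n))" using ia int by auto
    show "AE x in M. (\<lambda>k. rel_entropy g (a x) (s k x)) \<longlonglongrightarrow> rel_entropy g (a x) (u n x)"
    proof (rule AE_I2)
      fix x assume "x \<in> space M"
      then have "(\<lambda>k. (a x, s k x)) \<longlonglongrightarrow> (a x, u n x)" using s(2) by (intro tendsto_intros)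
      then have "(\<lambda>k. (\<lambda>z. rel_entropy g (fst z) (snd z)) (a x, s k x)) \<longlonglongrightarrow> (\<lambda>z. rel_entropy g (fst z) (snd z)) (a x, u n x)"
        by (rule continuous_on_tendsto_compose[OF continuous_rel_entropy]) auto
      then show "(\<lambda>k. rel_entropy g (a x) (s k x)) \<longlonglongrightarrow> rel_entropy g (a x) (u n x)" by simp
    qed
    fix k
    show "AE x in M. norm (rel_entropy g (a x) (s k x)) \<le> \<bar>g (a x)\<bar> + c1 + c2 * (norm (a x) + 2 * real n)"
    proof (rule AE_I2)
      fix x assume x: "x \<in> space M"
      have "\<bar>grad g (s k x) \<bullet> (a x - s k x)\<bar> \<le> norm (grad g (s k x)) * norm (a x - s k x)"
        by (rule Cauchy_Schwarz_ineq2)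
      also have "\<dots> \<le> c2 * (norm (a x) + 2 * real n)"
        using c2[OF sb[OF x, of k]] sb[OF x, of k] norm_triangle_ineq4[of "a x" "s k x"] norm_ge_zero[of "grad g (s k x)"]
          norm_ge_zero[of "a x - s k x"]
        by (intro mult_mono) linarith+
      finally show "norm (rel_entropy g (a x) (s k x)) \<le> \<bar>g (a x)\<bar> + c1 + c2 * (norm (a x) + 2 * real n)"
        using c1[OF sb[OF x], of k] by (simp add: rel_entropy_def)
    qed
  qed measurable
  then have "\<forall>\<^sub>F k in sequentially. (\<integral>x. rel_entropy g (a x) (s k x) \<partial>M) < \<delta>"
    using n by (intro order_tendstoD) auto
  then obtain k where k: "(\<integral>x. rel_entropy g (a x) (s k x) \<partial>M) < \<delta>"
    by (auto simp: eventually_sequentially)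
  have "norm (s k x) \<le> 2 * norm (a x)" if "x \<in> space M" for x
    using s(3)[OF that, of k] un(1)[of x] by linarith
  moreover have "s k x = 0" if "x \<in> space M" "norm (a x) > real n" for x
    using s(3)[OF that(1), of k] that(2) by (simp add: u_def)
  ultimately show ?thesis using s(1) k by (intro exI[of _ "real n"] exI[of _ "s k"]) auto
qed

text \<open>With the same \<open>s\<close> on both sides the terms \<open>g (s x)\<close> cancel.
  What remains is the entropy difference of \<open>w \<tau>\<close> and \<open>a\<close>,
  nonpositive by assumption, minus the integral of \<open>grad g (s x)\<close> against
  \<open>w \<tau> x - a x\<close>, which tends to 0.\<close>

lemma rel_entropy_limsup_le:
  assumes fin: "finite_measure M" and [measurable]: "a \<in> borel_measurable M"
    and int: "integrable M (\<lambda>x. g (a x))"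
    and w: "\<forall>\<^sub>F \<tau> in F. w \<tau> \<in> borel_measurable M \<and> integrable M (\<lambda>x. g (w \<tau> x))
        \<and> (\<integral>x. g (w \<tau> x) \<partial>M) \<le> (\<integral>x. g (a x) \<partial>M)"
    and weak: "\<And>B i. B \<in> sets M \<Longrightarrow> ((\<lambda>\<tau>. \<integral>x. indicator B x * ((w \<tau> x - a x) $ i) \<partial>M) \<longlongrightarrow> 0) F"
    and s: "simple_function M s" and "\<epsilon> > 0"
  shows "\<forall>\<^sub>F \<tau> in F. (\<integral>x. rel_entropy g (w \<tau> x) (s x) \<partial>M) < (\<integral>x. rel_entropy g (a x) (s x) \<partial>M) + \<epsilon>"
proof -
  interpret finite_measure M by fact
  have [measurable]: "s \<in> borel_measurable M" using s by (rule borel_measurable_simple_function)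
  obtain c where c: "\<And>x. x \<in> space M \<Longrightarrow> norm (s x) \<le> c" using simple_function_bounded[OF s] by auto
  define Y where "Y = s ` space M"
  have Y: "finite Y" using s unfolding Y_def by (rule simple_functionD)
  define B where "B y = s -` {y} \<inter> space M" for y
  have B: "B y \<in> sets M" for y unfolding B_def by measurable
  \<comment> \<open>The linear term sorted by the finitely many values of \<open>s\<close>, so that
    weak convergence on the level sets applies to each summand.\<close>
  define L where "L \<tau> = (\<Sum>y\<in>Y. \<Sum>i\<in>UNIV. grad g y $ i * (\<integral>x. indicator (B y) x * ((w \<tau> x - a x) $ i) \<partial>M))" for \<tau>
  have "(L \<longlongrightarrow> (\<Sum>y\<in>Y. \<Sum>i\<in>UNIV. grad g y $ i * 0)) F"
    unfolding L_def by (intro tendsto_intros weak B)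
  then have "\<forall>\<^sub>F \<tau> in F. L \<tau> > - \<epsilon>" using \<open>\<epsilon> > 0\<close> by (intro order_tendstoD) auto
  with w show ?thesis
  proof eventually_elim
    case (elim \<tau>)
    have [measurable]: "w \<tau> \<in> borel_measurable M" and iw: "integrable M (\<lambda>x. g (w \<tau> x))" using elim by auto
    have d: "integrable M (\<lambda>x. w \<tau> x - a x)"
      using integrable_of_entropy(1)[OF fin _ iw] integrable_of_entropy(1)[OF fin _ int] by auto
    have ind_int: "integrable M (\<lambda>x. indicator (B y) x * ((w \<tau> x - a x) $ i))" for y i
    proof -
      have "integrable M (\<lambda>x. indicator (B y) x *\<^sub>R (w \<tau> x - a x))"
        using B d by (rule integrable_mult_indicator)
      then have "integrable M (\<lambda>x. (indicator (B y) x *\<^sub>R (w \<tau> x - a x)) $ i)"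
        by (rule integrable_bounded_linear[OF bounded_linear_vec_nth])
      then show ?thesis by simp
    qed
    have lin: "(\<integral>x. grad g (s x) \<bullet> (w \<tau> x - a x) \<partial>M) = L \<tau>"
    proof -
      have "(\<integral>x. grad g (s x) \<bullet> (w \<tau> x - a x) \<partial>M)
        = (\<integral>x. (\<Sum>y\<in>Y. \<Sum>i\<in>UNIV. grad g y $ i * (indicator (B y) x * ((w \<tau> x - a x) $ i))) \<partial>M)"
      proof (rule Bochner_Integration.integral_cong)
        fix x assume x: "x \<in> space M"
        have "(\<Sum>y\<in>Y. \<Sum>i\<in>UNIV. grad g y $ i * (indicator (B y) x * ((w \<tau> x - a x) $ i)))
          = (\<Sum>y\<in>Y. if y = s x then grad g y \<bullet> (w \<tau> x - a x) else 0)"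
          using x by (intro sum.cong) (auto simp: B_def inner_vec_def)
        also have "\<dots> = grad g (s x) \<bullet> (w \<tau> x - a x)"
          using Y x by (simp add: Y_def)
        finally show "grad g (s x) \<bullet> (w \<tau> x - a x)
           = (\<Sum>y\<in>Y. \<Sum>i\<in>UNIV. grad g y $ i * (indicator (B y) x * ((w \<tau> x - a x) $ i)))" ..
      qed simp
      also have "\<dots> = L \<tau>"
        unfolding L_def using ind_int
        by (subst Bochner_Integration.integral_sum) (auto intro!: sum.cong Bochner_Integration.integrable_sum)
      finally show ?thesis .
    qed
    note iw3 = integrable_rel_entropy_bounded[OF fin _ _ iw c]
    note ia3 = integrable_rel_entropy_bounded[OF fin _ _ int c]
    have "(\<integral>x. rel_entropy g (w \<tau> x) (s x) \<partial>M) - (\<integral>x. rel_entropy g (a x) (s x) \<partial>M)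
       = (\<integral>x. rel_entropy g (w \<tau> x) (s x) - rel_entropy g (a x) (s x) \<partial>M)"
      using iw3 ia3 by simp
    also have "\<dots> = (\<integral>x. g (w \<tau> x) - g (a x) - grad g (s x) \<bullet> (w \<tau> x - a x) \<partial>M)"
      by (simp add: rel_entropy_def algebra_simps)
    also have "\<dots> = (\<integral>x. g (w \<tau> x) \<partial>M) - (\<integral>x. g (a x) \<partial>M) - L \<tau>"
    proof -
      have "integrable M (\<lambda>x. grad g (s x) \<bullet> (w \<tau> x - s x) - grad g (s x) \<bullet> (a x - s x))"
        using iw3 ia3 by auto
      then have "integrable M (\<lambda>x. grad g (s x) \<bullet> (w \<tau> x - a x))" by (simp add: inner_diff_right)
      then show ?thesis using iw int lin by simp
    qed
    finally show ?case using elim by simp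
  qed
qed

text \<open>The order of choices avoids a circle. \<open>K1\<close>, for comparison with 0, is fixed
  before \<open>s1\<close>; \<open>s1\<close> yields the cut-off \<open>R\<close>; only then are
  \<open>K2\<close>, for comparisons inside the ball of radius \<open>2 * R\<close>, and
  \<open>s2\<close> chosen. Where the norm of \<open>a\<close> exceeds \<open>R\<close>,
  \<open>s1\<close> vanishes and \<open>K1\<close> applies; elsewhere \<open>s2\<close> lies in that
  ball and \<open>K2\<close> applies.\<close>

lemma Lp_convergence:
  assumes fin: "finite_measure M" and a[measurable]: "a \<in> borel_measurable M"
    and int: "integrable M (\<lambda>x. g (a x))"
    and w: "\<forall>\<^sub>F \<tau> in F. w \<tau> \<in> borel_measurable M \<and> integrable M (\<lambda>x. g (w \<tau> x))
        \<and> (\<integral>x. g (w \<tau> x) \<partial>M) \<le> (\<integral>x. g (a x) \<partial>M)"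
    and weak: "\<And>B i. B \<in> sets M \<Longrightarrow> ((\<lambda>\<tau>. \<integral>x. indicator B x * ((w \<tau> x - a x) $ i) \<partial>M) \<longlongrightarrow> 0) F"
  shows "((\<lambda>\<tau>. \<integral>\<^sup>+x. ennreal (norm (w \<tau> x - a x) powr p) \<partial>M) \<longlongrightarrow> 0) F"
proof -
  interpret finite_measure M by fact
  have key: "\<forall>\<^sub>F \<tau> in F. (\<integral>\<^sup>+x. ennreal (norm (w \<tau> x - a x) powr p) \<partial>M) \<le> ennreal \<epsilon>" if \<epsilon>: "\<epsilon> > 0" for \<epsilon>
  proof -
    obtain K1 where K1: "K1 > 0" "\<And>x. norm x powr p \<le> K1 * rel_entropy g x 0"
      using rel_entropy_coercive[of 0] by auto
    define P where "P = (2::real) powr p"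
    have P: "P > 0" by (simp add: P_def)
    \<comment> \<open>Each approximation spends its tolerance three times, once for \<open>a\<close>
      and twice for \<open>w \<tau>\<close>, so the factor 6 leaves it a share of
      \<open>\<epsilon> / 2\<close>.\<close>
    define \<delta>1 where "\<delta>1 = \<epsilon> / (6 * P * K1)"
    have \<delta>1: "\<delta>1 > 0" using \<epsilon> P K1 by (simp add: \<delta>1_def)
    obtain R s1 where s1: "simple_function M s1" "\<And>x. x \<in> space M \<Longrightarrow> norm (a x) > R \<Longrightarrow> s1 x = 0"
      "(\<integral>x. rel_entropy g (a x) (s1 x) \<partial>M) < \<delta>1"
      using simple_approximation[OF fin a int \<delta>1] by blast
    obtain K2 where K2: "K2 > 0" "\<And>x b. norm b \<le> 2 * R \<Longrightarrow> norm (x - b) powr p \<le> K2 * rel_entropy g x b"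
      using rel_entropy_coercive[of "2 * R"] by auto
    define \<delta>2 where "\<delta>2 = \<epsilon> / (6 * P * K2)"
    have \<delta>2: "\<delta>2 > 0" using \<epsilon> P K2 by (simp add: \<delta>2_def)
    obtain s2 where s2: "simple_function M s2" "\<And>x. x \<in> space M \<Longrightarrow> norm (s2 x) \<le> 2 * norm (a x)"
      "(\<integral>x. rel_entropy g (a x) (s2 x) \<partial>M) < \<delta>2"
      using simple_approximation[OF fin a int \<delta>2] by blast
    have [measurable]: "s1 \<in> borel_measurable M" "s2 \<in> borel_measurable M"
      using s1(1) s2(1) by (auto intro: borel_measurable_simple_function)
    obtain c1 c2 where c: "\<And>x. x \<in> space M \<Longrightarrow> norm (s1 x) \<le> c1" "\<And>x. x \<in> space M \<Longrightarrow> norm (s2 x) \<le> c2"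
      using simple_function_bounded[OF s1(1)] simple_function_bounded[OF s2(1)] by auto
    have lim1: "\<forall>\<^sub>F \<tau> in F. (\<integral>x. rel_entropy g (w \<tau> x) (s1 x) \<partial>M) < (\<integral>x. rel_entropy g (a x) (s1 x) \<partial>M) + \<delta>1"
      by (rule rel_entropy_limsup_le[OF fin a int w weak s1(1) \<delta>1])
    have lim2: "\<forall>\<^sub>F \<tau> in F. (\<integral>x. rel_entropy g (w \<tau> x) (s2 x) \<partial>M) < (\<integral>x. rel_entropy g (a x) (s2 x) \<partial>M) + \<delta>2"
      by (rule rel_entropy_limsup_le[OF fin a int w weak s2(1) \<delta>2])
    show ?thesis
      using w lim1 lim2
    proof eventually_elim
      case (elim \<tau>)
      have [measurable]: "w \<tau> \<in> borel_measurable M" and iw: "integrable M (\<lambda>x. g (w \<tau> x))" using elim by auto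
      \<comment> \<open>One integrable majorant for both regions: on each of them one summand does
        the work and the other is merely nonnegative.\<close>
      define G where "G x = P * K1 * (rel_entropy g (w \<tau> x) (s1 x) + rel_entropy g (a x) (s1 x))
           + P * K2 * (rel_entropy g (w \<tau> x) (s2 x) + rel_entropy g (a x) (s2 x))" for x
      note i1 = integrable_rel_entropy_bounded(3)[OF fin _ _ iw c(1)] integrable_rel_entropy_bounded(3)[OF fin _ _ int c(1)]
      note i2 = integrable_rel_entropy_bounded(3)[OF fin _ _ iw c(2)] integrable_rel_entropy_bounded(3)[OF fin _ _ int c(2)]
      have G0: "G x \<ge> 0" for x
        using P K1(1) K2(1) rel_entropy_nonneg by (auto simp: G_def intro!: add_nonneg_nonneg mult_nonneg_nonneg)
      have pt: "norm (w \<tau> x - a x) powr p \<le> G x" if x: "x \<in> space M" for x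
      proof (cases "norm (a x) > R")
        case True
        then have [simp]: "s1 x = 0" using s1(2) x by simp
        have "norm (w \<tau> x - a x) powr p \<le> P * (norm (w \<tau> x) powr p + norm (a x) powr p)"
          using powr_norm_diff_le[of p "w \<tau> x" "a x" 0] p_ge_2 by (simp add: P_def)
        also have "\<dots> \<le> P * (K1 * rel_entropy g (w \<tau> x) 0 + K1 * rel_entropy g (a x) 0)"
          using P K1 by (intro mult_left_mono add_mono) auto
        also have "\<dots> = P * K1 * (rel_entropy g (w \<tau> x) (s1 x) + rel_entropy g (a x) (s1 x))"
          by (simp add: algebra_simps)
        also have "\<dots> \<le> G x"
          using P K2(1) rel_entropy_nonneg by (auto simp: G_def intro!: add_nonneg_nonneg mult_nonneg_nonneg)
        finally show ?thesis .
      next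
        case False
        then have b: "norm (s2 x) \<le> 2 * R" using s2(2)[OF x] by linarith
        have "norm (w \<tau> x - a x) powr p \<le> P * (norm (w \<tau> x - s2 x) powr p + norm (a x - s2 x) powr p)"
          using powr_norm_diff_le[of p "w \<tau> x" "a x" "s2 x"] p_ge_2 by (simp add: P_def)
        also have "\<dots> \<le> P * (K2 * rel_entropy g (w \<tau> x) (s2 x) + K2 * rel_entropy g (a x) (s2 x))"
          using P K2(2)[OF b] by (intro mult_left_mono add_mono) auto
        also have "\<dots> = P * K2 * (rel_entropy g (w \<tau> x) (s2 x) + rel_entropy g (a x) (s2 x))"
          by (simp add: algebra_simps)
        also have "\<dots> \<le> G x"
          using P K1(1) rel_entropy_nonneg by (auto simp: G_def intro!: add_nonneg_nonneg mult_nonneg_nonneg)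
        finally show ?thesis .
      qed
      have iG: "integrable M G" unfolding G_def using i1 i2 by auto
      have "(\<integral>\<^sup>+x. ennreal (norm (w \<tau> x - a x) powr p) \<partial>M) \<le> (\<integral>\<^sup>+x. ennreal (G x) \<partial>M)"
        by (intro nn_integral_mono ennreal_leI pt)
      also have "\<dots> = ennreal (\<integral>x. G x \<partial>M)"
        using iG G0 by (intro nn_integral_eq_integral) auto
      also have "(\<integral>x. G x \<partial>M) = P * K1 * ((\<integral>x. rel_entropy g (w \<tau> x) (s1 x) \<partial>M) + (\<integral>x. rel_entropy g (a x) (s1 x) \<partial>M))
         + P * K2 * ((\<integral>x. rel_entropy g (w \<tau> x) (s2 x) \<partial>M) + (\<integral>x. rel_entropy g (a x) (s2 x) \<partial>M))"
        unfolding G_def using i1 i2 by simp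
      also have "\<dots> \<le> P * K1 * (3 * \<delta>1) + P * K2 * (3 * \<delta>2)"
        using elim s1(3) s2(3) P K1(1) K2(1) by (intro add_mono mult_left_mono) auto
      also have "\<dots> = \<epsilon>" using P K1(1) K2(1) by (simp add: \<delta>1_def \<delta>2_def field_simps)
      finally show ?case by (simp add: ennreal_leI)
    qed
  qed
  show ?thesis
  proof (rule order_tendstoI)
    fix y :: ennreal assume "0 < y"
    then obtain z where z: "0 < z" "z < y" using dense by blast
    then obtain \<epsilon> where "z = ennreal \<epsilon>" by (cases z) auto
    with z have \<epsilon>: "\<epsilon> > 0" "ennreal \<epsilon> < y" by auto
    show "\<forall>\<^sub>F \<tau> in F. (\<integral>\<^sup>+x. ennreal (norm (w \<tau> x - a x) powr p) \<partial>M) < y"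
      using key[OF \<epsilon>(1)] by eventually_elim (use \<epsilon> in auto)
  qed simp
qed

end

section \<open>Test functions\<close>

lemma has_real_derivative_square_pos_part:
  "((\<lambda>y. (max 0 y)\<^sup>2) has_real_derivative 2 * max 0 y) (at y)" for y :: real
proof -
  consider "y > 0" | "y < 0" | "y = 0" by linarith
  then show ?thesis
  proof cases
    case 1
    then have "((\<lambda>y. y\<^sup>2) has_real_derivative 2 * max 0 y) (at y)"
      by (auto intro!: derivative_eq_intros)
    then show ?thesis
      by (rule has_field_derivative_transform_within_open[where S="{0<..}"]) (use 1 in auto)
  next
    case 2
    then have "((\<lambda>y. 0) has_real_derivative 2 * max 0 y) (at y)"
      by (auto intro!: derivative_eq_intros)
    then show ?thesis
      by (rule has_field_derivative_transform_within_open[where S="{..<0}"]) (use 2 in auto)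
  next
    case 3
    have "((\<lambda>h. (max 0 h)\<^sup>2 / h) \<longlongrightarrow> 0) (at (0::real))"
    proof (rule Lim_null_comparison)
      show "\<forall>\<^sub>F h in at (0::real). norm ((max 0 h)\<^sup>2 / h) \<le> \<bar>h\<bar>"
        by (auto simp: max_def power2_eq_square)
      show "((\<lambda>h. \<bar>h\<bar>) \<longlongrightarrow> 0) (at (0::real))"
        by (intro tendsto_rabs_zero tendsto_ident_at)
    qed
    then show ?thesis using 3 by (simp add: DERIV_def)
  qed
qed

text \<open>A C1 version of the sharp ramp, with \<open>sqrt (\<delta>^2 + m^2) - \<delta>\<close>
  in place of the positive part m of \<tau> - t. Squaring the positive part removes its kink at t =
  \<tau>, and a positive \<delta> keeps the argument of the root away from 0. The result still
  vanishes exactly from \<tau> on and lies below the sharp ramp.\<close>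

definition time_ramp :: "real \<Rightarrow> real \<Rightarrow> real \<Rightarrow> real" where
  "time_ramp \<delta> \<tau> t = (sqrt (\<delta>\<^sup>2 + (max 0 (\<tau> - t))\<^sup>2) - \<delta>) / \<tau>"

definition time_ramp' :: "real \<Rightarrow> real \<Rightarrow> real \<Rightarrow> real" where
  "time_ramp' \<delta> \<tau> t = - (max 0 (\<tau> - t) / sqrt (\<delta>\<^sup>2 + (max 0 (\<tau> - t))\<^sup>2)) / \<tau>"

lemma time_ramp_derivative:
  assumes "\<delta> > 0"
  shows "(time_ramp \<delta> \<tau> has_real_derivative time_ramp' \<delta> \<tau> t) (at t)"
proof -
  define m where "m = max 0 (\<tau> - t)"
  have pos: "\<delta>\<^sup>2 + m\<^sup>2 > 0" using assms by (simp add: add_pos_nonneg)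
  have "((\<lambda>t. \<tau> - t) has_real_derivative -1) (at t)" by (auto intro!: derivative_eq_intros)
  from DERIV_chain2[where f="\<lambda>y. (max 0 y)\<^sup>2" and g="\<lambda>t. \<tau> - t",
      OF has_real_derivative_square_pos_part[of "\<tau> - t"] this]
  have "((\<lambda>t. (max 0 (\<tau> - t))\<^sup>2) has_real_derivative - (2 * m)) (at t)"
    by (simp add: m_def)
  then have "((\<lambda>t. \<delta>\<^sup>2 + (max 0 (\<tau> - t))\<^sup>2) has_real_derivative 0 + - (2 * m)) (at t)"
    by (intro DERIV_add DERIV_const)
  with pos have "((\<lambda>t. sqrt (\<delta>\<^sup>2 + (max 0 (\<tau> - t))\<^sup>2)) has_real_derivative
      (inverse (sqrt (\<delta>\<^sup>2 + m\<^sup>2)) / 2) * (0 + - (2 * m))) (at t)"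
    unfolding m_def by (intro DERIV_chain2[where f=sqrt] DERIV_real_sqrt)
  then have "((\<lambda>t. (sqrt (\<delta>\<^sup>2 + (max 0 (\<tau> - t))\<^sup>2) - \<delta>) / \<tau>) has_real_derivative
      ((inverse (sqrt (\<delta>\<^sup>2 + m\<^sup>2)) / 2) * (0 + - (2 * m)) - 0) / \<tau>) (at t)"
    by (intro DERIV_cdivide DERIV_diff DERIV_const)
  moreover have "((inverse (sqrt (\<delta>\<^sup>2 + m\<^sup>2)) / 2) * (0 + - (2 * m)) - 0) / \<tau> = time_ramp' \<delta> \<tau> t"
  proof -
    have "(inverse r / 2) * (0 + - (2 * m)) - 0 = - (m / r)" for r
      by (cases "r = 0") (auto simp: field_simps)
    then show ?thesis unfolding time_ramp'_def m_def by simp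
  qed
  moreover have "time_ramp \<delta> \<tau> = (\<lambda>t. (sqrt (\<delta>\<^sup>2 + (max 0 (\<tau> - t))\<^sup>2) - \<delta>) / \<tau>)"
    by (simp add: time_ramp_def fun_eq_iff)
  ultimately show ?thesis by (simp only:)
qed

lemma continuous_on_time_ramp': "\<delta> > 0 \<Longrightarrow> continuous_on S (time_ramp' \<delta> \<tau>)"
proof (cases "\<tau> = 0")
  case False
  assume "\<delta> > 0"
  then have "sqrt (\<delta>\<^sup>2 + (max 0 (\<tau> - t))\<^sup>2) \<noteq> 0" for t
    by (metis add_pos_nonneg order_less_irrefl real_sqrt_eq_zero_cancel_iff zero_le_power2 zero_less_power)
  with False show ?thesis unfolding time_ramp'_def[abs_def] by (intro continuous_intros) auto
qed (simp add: time_ramp'_def)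

lemma time_ramp_bounds:
  assumes "\<delta> > 0" "\<tau> > 0"
  shows "0 \<le> time_ramp \<delta> \<tau> t" "time_ramp \<delta> \<tau> t \<le> max 0 (\<tau> - t) / \<tau>"
    "-1 / \<tau> \<le> time_ramp' \<delta> \<tau> t" "time_ramp' \<delta> \<tau> t \<le> 0"
    "t \<ge> \<tau> \<Longrightarrow> time_ramp \<delta> \<tau> t = 0"
proof -
  define m where "m = max 0 (\<tau> - t)"
  have m: "m \<ge> 0" by (simp add: m_def)
  have "\<delta> \<le> sqrt (\<delta>\<^sup>2 + m\<^sup>2)" using assms by (intro real_le_rsqrt) simp
  then show "0 \<le> time_ramp \<delta> \<tau> t" using assms by (simp add: time_ramp_def m_def)
  have "sqrt (\<delta>\<^sup>2 + m\<^sup>2) \<le> \<delta> + m" using assms m by (intro sqrt_sum_squares_le_sum) auto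
  then show "time_ramp \<delta> \<tau> t \<le> max 0 (\<tau> - t) / \<tau>"
    using assms by (simp add: time_ramp_def m_def divide_right_mono)
  have s: "m \<le> sqrt (\<delta>\<^sup>2 + m\<^sup>2)" "sqrt (\<delta>\<^sup>2 + m\<^sup>2) > 0"
    using assms by (auto intro!: real_le_rsqrt add_pos_nonneg)
  then have "m / sqrt (\<delta>\<^sup>2 + m\<^sup>2) \<le> 1" by simp
  then show "-1 / \<tau> \<le> time_ramp' \<delta> \<tau> t"
    unfolding time_ramp'_def m_def[symmetric] using assms by (intro divide_right_mono) auto
  show "time_ramp' \<delta> \<tau> t \<le> 0"
    unfolding time_ramp'_def m_def[symmetric] using assms m s by simp
  show "t \<ge> \<tau> \<Longrightarrow> time_ramp \<delta> \<tau> t = 0" using assms by (simp add: time_ramp_def)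
qed

definition ramp_eps :: "nat \<Rightarrow> real" where "ramp_eps n = inverse (real (Suc n))"

lemma ramp_eps_pos: "ramp_eps n > 0"
  by (simp add: ramp_eps_def)

lemma ramp_eps_tendsto: "ramp_eps \<longlonglongrightarrow> 0"
  unfolding ramp_eps_def by (rule LIMSEQ_inverse_real_of_nat)

lemma time_ramp_tendsto:
  "(\<lambda>n. time_ramp (ramp_eps n) \<tau> t) \<longlonglongrightarrow> max 0 (\<tau> - t) / \<tau>"
proof (cases "\<tau> = 0")
  case False
  have "(\<lambda>n. time_ramp (ramp_eps n) \<tau> t) \<longlonglongrightarrow> (sqrt (0\<^sup>2 + (max 0 (\<tau> - t))\<^sup>2) - 0) / \<tau>"
    unfolding time_ramp_def using False by (intro tendsto_intros ramp_eps_tendsto)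
  then show ?thesis by simp
qed (simp add: time_ramp_def)

lemma time_ramp'_tendsto:
  "(\<lambda>n. time_ramp' (ramp_eps n) \<tau> t) \<longlonglongrightarrow> - indicator {..<\<tau>} t / \<tau>"
proof (cases "t < \<tau>")
  case True
  have "(\<lambda>n. - (max 0 (\<tau> - t) / sqrt ((ramp_eps n)\<^sup>2 + (max 0 (\<tau> - t))\<^sup>2)) * inverse \<tau>)
     \<longlonglongrightarrow> - (max 0 (\<tau> - t) / sqrt (0\<^sup>2 + (max 0 (\<tau> - t))\<^sup>2)) * inverse \<tau>"
    using True by (intro tendsto_intros ramp_eps_tendsto) auto
  then show ?thesis using True by (simp add: time_ramp'_def divide_inverse)
qed (simp add: time_ramp'_def)

section \<open>Periodic C1 approximations of indicators of boxes\<close>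

definition bump_profile :: "nat \<Rightarrow> real \<Rightarrow> real" where
  "bump_profile k y = 1 - exp (- (real k * (max 0 y)\<^sup>2))"

text \<open>For b in [0, 2 pi], the function cos(x - b/2) - cos(b/2) is 2 pi-periodic and, within
  one period, positive exactly on (0, b). \<open>bump_profile k\<close> is C1 and tends to the
  indicator of the positive reals as \<open>k\<close> grows; composing and multiplying over the
  coordinates therefore gives a periodic C1 function that tends to the indicator of an open
  box.\<close>

definition torus_bump :: "nat \<Rightarrow> real^'d \<Rightarrow> real^'d \<Rightarrow> real" where
  "torus_bump k b x = (\<Prod>i\<in>UNIV. bump_profile k (cos (x $ i - b $ i / 2) - cos (b $ i / 2)))"

lemma bump_profile_bounds: "0 \<le> bump_profile k y" "bump_profile k y \<le> 1"
  by (auto simp: bump_profile_def)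

lemma torus_bump_bounds: "0 \<le> torus_bump k b x" "torus_bump k b x \<le> 1"
  unfolding torus_bump_def
  by (auto intro!: prod_nonneg prod_le_1 bump_profile_bounds)

lemma bump_profile_derivative:
  "(bump_profile k has_real_derivative exp (- (real k * (max 0 y)\<^sup>2)) * (real k * (2 * max 0 y))) (at y)"
  unfolding bump_profile_def[abs_def]
  by (rule derivative_eq_intros has_real_derivative_square_pos_part refl | simp)+

lemma torus_bump_C1:
  shows "\<exists>h'. (\<forall>x. (torus_bump k b has_derivative h' x) (at x))
      \<and> (\<forall>e. continuous_on UNIV (\<lambda>x. h' x e))" (is ?C)
    and "periodic_x (torus_bump k b)"
proof -
  define D where "D i x h = (h $ i * - sin (x $ i - b $ i / 2)) *
     (exp (- (real k * (max 0 (cos (x $ i - b $ i / 2) - cos (b $ i / 2)))\<^sup>2)) *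
       (real k * (2 * max 0 (cos (x $ i - b $ i / 2) - cos (b $ i / 2)))))" for i and x h :: "real^'a"
  have cont: "continuous_on UNIV (bump_profile k)"
    unfolding bump_profile_def[abs_def] by (intro continuous_intros)
  have d: "((\<lambda>x. bump_profile k (cos (x $ i - b $ i / 2) - cos (b $ i / 2))) has_derivative D i x) (at x)" for i x
  proof -
    have inner: "((\<lambda>x. cos (x $ i - b $ i / 2) - cos (b $ i / 2)) has_derivative
        (\<lambda>h. h $ i * - sin (x $ i - b $ i / 2))) (at x)"
      by (auto intro!: derivative_eq_intros bounded_linear_imp_has_derivative)
    show ?thesis
      using has_derivative_compose[OF inner bump_profile_derivative[unfolded has_field_derivative_def]]
      by (rule has_derivative_eq_rhs) (simp add: D_def fun_eq_iff mult_ac)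
  qed
  define h' where "h' x h = (\<Sum>i\<in>UNIV. D i x h * (\<Prod>j\<in>UNIV - {i}. bump_profile k (cos (x $ j - b $ j / 2) - cos (b $ j / 2))))" for x h
  have "(torus_bump k b has_derivative h' x) (at x)" for x
    unfolding torus_bump_def[abs_def] h'_def by (intro has_derivative_prod d)
  moreover have "continuous_on UNIV (\<lambda>x. h' x e)" for e
    unfolding h'_def D_def
    by (intro continuous_intros continuous_on_compose2[OF cont _ subset_UNIV])
  ultimately show ?C by blast
  show "periodic_x (torus_bump k b)"
    unfolding periodic_x_def torus_bump_def
  proof (intro allI prod.cong refl)
    fix x :: "real^'a" and i j
    have "cos ((x + (2 * pi) *\<^sub>R axis i 1) $ j - b $ j / 2) = cos (x $ j - b $ j / 2)"
      using cos_periodic[of "x $ j - b $ j / 2"] by (cases "i = j") (auto simp: axis_def algebra_simps)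
    then show "bump_profile k (cos ((x + (2 * pi) *\<^sub>R axis i 1) $ j - b $ j / 2) - cos (b $ j / 2))
       = bump_profile k (cos (x $ j - b $ j / 2) - cos (b $ j / 2))" by simp
  qed
qed

lemma bump_profile_tendsto: "(\<lambda>k. bump_profile k y) \<longlonglongrightarrow> indicator {0<..} y"
proof (cases "y > 0")
  case True
  then have "(\<lambda>k. exp (- (y\<^sup>2)) ^ k) \<longlonglongrightarrow> 0"
    by (intro LIMSEQ_realpow_zero) auto
  from tendsto_diff[OF tendsto_const this] have "(\<lambda>k. 1 - exp (- (y\<^sup>2)) ^ k) \<longlonglongrightarrow> 1 - 0" .
  then show ?thesis using True by (simp add: bump_profile_def exp_of_nat_mult[symmetric])
qed (simp add: bump_profile_def)

text \<open>The difference factors as \<open>2 * (sin (x / 2) * sin ((b - x) / 2))\<close>: the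
  first sine is positive inside the period, the second has the sign of \<open>b - x\<close>.\<close>

lemma cos_half_less_iff:
  assumes "0 < x" "x < 2 * pi" "0 \<le> b" "b \<le> 2 * pi"
  shows "0 < cos (x - b / 2) - cos (b / 2) \<longleftrightarrow> x < b"
proof -
  have eq: "cos (x - b / 2) - cos (b / 2) = 2 * (sin (x / 2) * sin ((b - x) / 2))"
  proof -
    have "(x - b / 2 + b / 2) / 2 = x / 2" "(b / 2 - (x - b / 2)) / 2 = (b - x) / 2"
      by (simp_all add: field_simps)
    then show ?thesis using cos_diff_cos[of "x - b / 2" "b / 2"] by simp
  qed
  have s: "sin (x / 2) > 0" using assms by (intro sin_gt_zero) auto
  consider "x < b" | "x = b" | "x > b" by linarith
  then show ?thesis
  proof cases
    case 1
    then have "sin ((b - x) / 2) > 0" using assms by (intro sin_gt_zero) auto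
    then show ?thesis using 1 s eq by simp
  next
    case 2
    then show ?thesis using eq by simp
  next
    case 3
    then have "sin ((x - b) / 2) > 0" using assms by (intro sin_gt_zero) auto
    moreover have "sin ((b - x) / 2) = - sin ((x - b) / 2)"
      using sin_minus[of "(x - b) / 2"] by (simp add: minus_divide_left)
    ultimately show ?thesis using 3 s eq by (simp add: mult_le_0_iff not_less)
  qed
qed

text \<open>Clamping the corner to [0, 2 pi] in each coordinate does not affect points of the open
  cube. The excluded hyperplanes are those where the strict inequalities of the bump and the closed
  orthant can disagree; they form a null set.\<close>

lemma torus_bump_tendsto:
  fixes a x :: "real^'d"
  assumes "x \<in> torusQ" "\<And>i. x $ i \<noteq> 0" "\<And>i. x $ i \<noteq> a $ i"
  shows "(\<lambda>k. torus_bump k (\<chi> i. min (max (a $ i) 0) (2 * pi)) x) \<longlonglongrightarrow> indicator {..a} x"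
proof -
  define b :: "real^'d" where "b = (\<chi> i. min (max (a $ i) 0) (2 * pi))"
  have x: "0 < x $ i" "x $ i < 2 * pi" for i
    using assms(1) assms(2)[of i] by (auto simp: torusQ_def less_le)
  have "(\<lambda>k. torus_bump k b x) \<longlonglongrightarrow> (\<Prod>i\<in>UNIV. indicator {0<..} (cos (x $ i - b $ i / 2) - cos (b $ i / 2)))"
    unfolding torus_bump_def by (intro tendsto_prod bump_profile_tendsto)
  also have "(\<Prod>i\<in>UNIV. indicator {0<..} (cos (x $ i - b $ i / 2) - cos (b $ i / 2))) = (\<Prod>i\<in>UNIV. (if x $ i \<le> a $ i then 1 else (0::real)))"
  proof (intro prod.cong refl)
    fix i
    have "0 < cos (x $ i - b $ i / 2) - cos (b $ i / 2) \<longleftrightarrow> x $ i < b $ i"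
      using x[of i] by (intro cos_half_less_iff) (auto simp: b_def)
    also have "\<dots> \<longleftrightarrow> x $ i \<le> a $ i"
      using x[of i] assms(3)[of i] by (auto simp: b_def)
    finally show "indicator {0<..} (cos (x $ i - b $ i / 2) - cos (b $ i / 2)) = (if x $ i \<le> a $ i then 1 else (0::real))"
      by (simp add: indicator_def)
  qed
  also have "\<dots> = indicator {..a} x"
    by (auto simp: indicator_def less_eq_vec_def prod_zero_iff split: if_splits)
  finally show ?thesis by (simp add: b_def)
qed

text \<open>The product form lets each partial derivative fall on a single factor, and the
  coordinate vector isolates the \<open>j\<close>-th equation of the system.\<close>

lemma separated_test_function:
  fixes h :: "real^'d \<Rightarrow> real" and j :: "'n::finite"
  assumes \<theta>: "\<And>t. (\<theta> has_real_derivative \<theta>' t) (at t)" "continuous_on UNIV \<theta>'"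
      "\<And>t. t \<ge> T' \<Longrightarrow> \<theta> t = 0" "T' < T"
    and h: "\<And>x. (h has_derivative h' x) (at x)" "\<And>e. continuous_on UNIV (\<lambda>x. h' x e)" "periodic_x h"
  defines "\<psi> \<equiv> (\<lambda>z. (\<theta> (snd z) * h (fst z)) *\<^sub>R (axis j 1 :: real^'n))"
  shows "\<psi> \<in> C1c_test T"
    and "pd \<psi> (0, 1) z = (\<theta>' (snd z) * h (fst z)) *\<^sub>R axis j 1"
    and "pd \<psi> (e, 0) z = (\<theta> (snd z) * h' (fst z) e) *\<^sub>R axis j 1"
proof -
  define \<psi>' where "\<psi>' z k = (\<theta> (snd z) * h' (fst z) (fst k) + (snd k * \<theta>' (snd z)) * h (fst z)) *\<^sub>R (axis j 1 :: real^'n)"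
    for z k :: "(real^'d) \<times> real"
  have deriv: "(\<psi> has_derivative \<psi>' z) (at z)" for z
  proof -
    have 1: "((\<lambda>z. \<theta> (snd z)) has_derivative (\<lambda>k. snd k * \<theta>' (snd z))) (at z)"
      using has_derivative_compose[OF has_derivative_snd[OF has_derivative_ident] \<theta>(1)[unfolded has_field_derivative_def], of z UNIV]
      by (rule has_derivative_eq_rhs) (simp add: mult.commute)
    have 2: "((\<lambda>z. h (fst z)) has_derivative (\<lambda>k. h' (fst z) (fst k))) (at z)"
      using has_derivative_compose[OF has_derivative_fst[OF has_derivative_ident] h(1), of z UNIV] .
    show ?thesis unfolding \<psi>_def \<psi>'_def
      by (intro has_derivative_scaleR_left has_derivative_mult 1 2)
  qed
  have lin: "h' x 0 = 0" for x using has_derivative_bounded_linear[OF h(1)] by (rule linear_simps)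
  show "pd \<psi> (0, 1) z = (\<theta>' (snd z) * h (fst z)) *\<^sub>R axis j 1"
    "pd \<psi> (e, 0) z = (\<theta> (snd z) * h' (fst z) e) *\<^sub>R axis j 1"
    using pd_has_derivative[OF deriv] lin by (auto simp: \<psi>'_def)
  have c: "continuous_on UNIV \<theta>" "continuous_on UNIV h"
    using \<theta>(1) h(1) by (auto intro!: DERIV_atLeastAtMost_imp_continuous_on continuous_at_imp_continuous_on
        dest: DERIV_isCont has_derivative_continuous)
  have "C1 \<psi>"
    using deriv
  proof (rule C1I)
    fix e :: "(real^'d) \<times> real"
    show "continuous_on UNIV (\<lambda>z. \<psi>' z e)"
      unfolding \<psi>'_def
      by (intro continuous_intros continuous_on_compose2[OF c(1) _ subset_UNIV] continuous_on_compose2[OF c(2) _ subset_UNIV]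
          continuous_on_compose2[OF \<theta>(2) _ subset_UNIV] continuous_on_compose2[OF h(2) _ subset_UNIV])
  qed
  then show "\<psi> \<in> C1c_test T"
    using \<theta>(3,4) h(3) by (auto simp: C1c_test_def periodic_xt_def periodic_x_def \<psi>_def)
qed

lemma time_ramp_test:
  assumes "\<delta> > 0" "0 < \<tau>" "\<tau> < T"
  shows "time_ramp \<delta> \<tau> \<in> C1c_time_nonneg T" "pd (time_ramp \<delta> \<tau>) 1 t = time_ramp' \<delta> \<tau> t"
proof -
  have d: "(time_ramp \<delta> \<tau> has_derivative (\<lambda>s. s * time_ramp' \<delta> \<tau> t)) (at t)" for t
    using time_ramp_derivative[OF assms(1), of \<tau> t]
    unfolding has_field_derivative_def by (rule has_derivative_eq_rhs) (simp add: fun_eq_iff mult.commute)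
  show "pd (time_ramp \<delta> \<tau>) 1 t = time_ramp' \<delta> \<tau> t" using pd_has_derivative[OF d] by simp
  have "C1 (time_ramp \<delta> \<tau>)"
    using d by (rule C1I) (use continuous_on_time_ramp'[OF assms(1)] in \<open>auto intro!: continuous_intros\<close>)
  then show "time_ramp \<delta> \<tau> \<in> C1c_time_nonneg T"
    using time_ramp_bounds[OF assms(1,2)] assms(3) by (auto simp: C1c_time_nonneg_def)
qed

section \<open>Integrals over the space-time cylinder\<close>

lemma torusQ_borel [measurable]: "torusQ \<in> sets borel"
proof -
  have "torusQ = (\<Inter>i\<in>UNIV. {x :: real^'d. 0 \<le> x $ i} \<inter> {x. x $ i < 2 * pi})"
    by (auto simp: torusQ_def)
  also have "\<dots> \<in> sets borel" by (intro sets.finite_INT sets.Int) auto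
  finally show ?thesis .
qed

lemma torusQ_subset_cbox: "torusQ \<subseteq> cbox 0 (\<chi> i. 2 * pi)"
  by (auto simp: torusQ_def mem_box_cart less_imp_le)

lemma emeasure_torusQ: "emeasure lborel (torusQ :: (real^'d) set) \<noteq> 0" "emeasure lborel (torusQ :: (real^'d) set) < \<infinity>"
proof -
  have "box 0 (\<chi> i. 2 * pi) \<subseteq> (torusQ :: (real^'d) set)"
    by (auto simp: torusQ_def mem_box_cart less_imp_le)
  then have "emeasure lborel (box 0 (\<chi> i. 2 * pi) :: (real^'d) set) \<le> emeasure lborel (torusQ :: (real^'d) set)"
    by (intro emeasure_mono) auto
  moreover have "emeasure lborel (box 0 (\<chi> i. 2 * pi) :: (real^'d) set) > 0"
    by (auto simp: emeasure_lborel_box_eq Basis_vec_def inner_axis intro!: prod_pos)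
  ultimately show "emeasure lborel (torusQ :: (real^'d) set) \<noteq> 0" by auto
  have "emeasure lborel (torusQ :: (real^'d) set) \<le> emeasure lborel (cbox 0 (\<chi> i. 2 * pi) :: (real^'d) set)"
    by (intro emeasure_mono torusQ_subset_cbox) auto
  also have "\<dots> < \<infinity>" by (rule emeasure_lborel_cbox_finite)
  finally show "emeasure lborel (torusQ :: (real^'d) set) < \<infinity>" .
qed

lemma continuous_bounded_torusQ:
  fixes g :: "real^'d \<Rightarrow> real"
  assumes "continuous_on UNIV g"
  shows "\<exists>K. \<forall>x\<in>torusQ. \<bar>g x\<bar> \<le> K"
proof -
  have "bounded (g ` cbox 0 (\<chi> i. 2 * pi))"
    by (intro compact_imp_bounded compact_continuous_image compact_cbox continuous_on_subset[OF assms]) auto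
  then show ?thesis using torusQ_subset_cbox unfolding bounded_iff by (metis image_eqI real_norm_def subsetD)
qed

lemma finite_measure_torusQ: "finite_measure (restrict_space lborel (torusQ :: (real^'d) set))"
  using emeasure_torusQ(2)[where 'd='d]
  by (intro finite_measureI) (simp add: space_restrict_space emeasure_restrict_space less_top)

lemma sets_times_torusQ [measurable]: "(torusQ :: (real^'d) set) \<times> {0..\<tau>::real} \<in> sets borel"
  unfolding borel_prod[symmetric] by (intro pair_measureI) auto

lemma AE_snd_neq: "AE z in lborel. snd (z :: 'a::euclidean_space \<times> real) \<noteq> c"
  using AE_lborel_inner_neq[of "(0, 1) :: 'a \<times> real" c] by (simp add: inner_prod_def Basis_prod_def)

lemma space_time_fubini:
  fixes H :: "(real^'d) \<times> real \<Rightarrow> 'b::{banach,second_countable_topology}"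
  assumes "set_integrable lborel (torusQ \<times> {0..\<tau>}) H"
  shows "AE x in lborel. x \<in> torusQ \<longrightarrow> set_integrable lborel {0..\<tau>} (\<lambda>t. H (x, t))"
    and "set_integrable lborel torusQ (\<lambda>x. LINT t:{0..\<tau>}|lborel. H (x, t))"
    and "(LINT x:torusQ|lborel. (LINT t:{0..\<tau>}|lborel. H (x, t))) = (LINT z:torusQ \<times> {0..\<tau>}|lborel. H z)"
proof -
  define J where "J z = indicator (torusQ \<times> {0..\<tau>}) z *\<^sub>R H z" for z
  have int: "integrable (lborel \<Otimes>\<^sub>M lborel) J"
    using assms by (simp add: set_integrable_def J_def[abs_def] lborel_prod)
  have J: "J (x, t) = indicator torusQ x *\<^sub>R (indicator {0..\<tau>} t *\<^sub>R H (x, t))" for x t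
    by (simp add: J_def indicator_times)
  have JI: "(\<integral>t. J (x, t) \<partial>lborel) = indicator torusQ x *\<^sub>R (LINT t:{0..\<tau>}|lborel. H (x, t))" for x
    unfolding J set_lebesgue_integral_def by (cases "x \<in> torusQ") auto
  show "AE x in lborel. x \<in> torusQ \<longrightarrow> set_integrable lborel {0..\<tau>} (\<lambda>t. H (x, t))"
    using lborel_pair.AE_integrable_fst'[OF int] by eventually_elim (auto simp: J set_integrable_def)
  have "integrable lborel (\<lambda>x. \<integral>t. J (x, t) \<partial>lborel)"
    by (rule lborel_pair.integrable_fst'[OF int])
  then show "set_integrable lborel torusQ (\<lambda>x. LINT t:{0..\<tau>}|lborel. H (x, t))"
    by (simp add: JI set_integrable_def)
  have "(\<integral>x. (\<integral>t. J (x, t) \<partial>lborel) \<partial>lborel) = integral\<^sup>L (lborel \<Otimes>\<^sub>M lborel) J"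
    by (rule lborel_pair.integral_fst'[OF int])
  then show "(LINT x:torusQ|lborel. (LINT t:{0..\<tau>}|lborel. H (x, t))) = (LINT z:torusQ \<times> {0..\<tau>}|lborel. H z)"
    unfolding JI set_lebesgue_integral_def[of lborel torusQ] set_lebesgue_integral_def[of lborel "torusQ \<times> {0..\<tau>}"]
    by (simp add: lborel_prod J_def[abs_def])
qed

lemma set_integrable_times_mono:
  fixes H :: "_ \<Rightarrow> 'b::{banach,second_countable_topology}"
  assumes "set_integrable lborel ((torusQ :: (real^'d) set) \<times> {0..T::real}) H" "\<tau> \<le> T"
  shows "set_integrable lborel (torusQ \<times> {0..\<tau>}) H"
  using assms by (intro set_integrable_subset[OF assms(1)]) auto

lemma set_integrable_bounded_mult:
  fixes H c :: "'a \<Rightarrow> real"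
  assumes H: "set_integrable M S H" and c: "c \<in> borel_measurable M" "\<And>z. z \<in> S \<Longrightarrow> \<bar>c z\<bar> \<le> K"
  shows "set_integrable M S (\<lambda>z. c z * H z)"
  unfolding set_integrable_def
proof (rule Bochner_Integration.integrable_bound[where f="\<lambda>z. K * (indicator S z *\<^sub>R H z)"])
  show "integrable M (\<lambda>z. K * (indicator S z *\<^sub>R H z))" using H by (simp add: set_integrable_def)
  have "(\<lambda>z. c z * (indicator S z *\<^sub>R H z)) \<in> borel_measurable M"
    using H c(1) by (intro borel_measurable_times) (auto simp: set_integrable_def)
  then show "(\<lambda>z. indicator S z *\<^sub>R (c z * H z)) \<in> borel_measurable M" by (simp add: mult_ac)
  show "AE z in M. norm (indicator S z *\<^sub>R (c z * H z)) \<le> norm (K * (indicator S z *\<^sub>R H z))"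
  proof (rule AE_I2)
    fix z
    show "norm (indicator S z *\<^sub>R (c z * H z)) \<le> norm (K * (indicator S z *\<^sub>R H z))"
    proof (cases "z \<in> S")
      case True
      then have "\<bar>c z\<bar> * \<bar>H z\<bar> \<le> \<bar>K\<bar> * \<bar>H z\<bar>" using c(2) by (intro mult_right_mono) force+
      then show ?thesis using True by (simp add: abs_mult)
    qed simp
  qed
qed

lemma measurable_snd_borel:
  "g \<in> borel_measurable borel \<Longrightarrow> (\<lambda>z. g (snd z)) \<in> borel_measurable (borel :: ('a::euclidean_space \<times> real) measure)"
  by (rule measurable_compose[OF borel_measurable_continuous_onI[OF continuous_on_snd[OF continuous_on_id]]])

lemma time_ramp_measurable [measurable]:
  "(\<lambda>z. time_ramp \<delta> \<tau> (snd z)) \<in> borel_measurable (borel :: ('a::euclidean_space \<times> real) measure)"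
  "(\<lambda>z. time_ramp' \<delta> \<tau> (snd z)) \<in> borel_measurable (borel :: ('a::euclidean_space \<times> real) measure)"
  unfolding time_ramp_def[abs_def] time_ramp'_def[abs_def] by (intro measurable_snd_borel; measurable)+

text \<open>This is where time averages come from: the derivatives of the smoothed ramps are bounded
  by \<open>1 / \<tau>\<close> in absolute value and tend to \<open>- 1 / \<tau>\<close> on [0,
  \<tau>), so dominated convergence applies.\<close>

lemma time_ramp'_integral_tendsto:
  fixes H :: "(real^'d) \<times> real \<Rightarrow> real"
  assumes H: "set_integrable lborel (torusQ \<times> {0..T}) H" and \<tau>: "0 < \<tau>" "\<tau> < T"
  shows "(\<lambda>n. LINT z:torusQ \<times> {0..T}|lborel. time_ramp' (ramp_eps n) \<tau> (snd z) * H z)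
    \<longlonglongrightarrow> - (LINT z:torusQ \<times> {0..\<tau>}|lborel. H z) / \<tau>"
proof -
  have m1: "(\<lambda>z. indicator (torusQ \<times> {0..T}) z * H z) \<in> borel_measurable borel"
    using H by (simp add: set_integrable_def integrable_iff_bounded)
  have m2: "(\<lambda>z. indicator (torusQ \<times> {0..\<tau>}) z * H z) \<in> borel_measurable borel"
    using set_integrable_times_mono[OF H, of \<tau>] \<tau> by (simp add: set_integrable_def integrable_iff_bounded)
  have "(\<lambda>n. \<integral>z. time_ramp' (ramp_eps n) \<tau> (snd z) * (indicator (torusQ \<times> {0..T}) z * H z) \<partial>lborel)
     \<longlonglongrightarrow> (\<integral>z. - (indicator (torusQ \<times> {0..\<tau>}) z * H z) / \<tau> \<partial>lborel)"
  proof (rule integral_dominated_convergence[where w="\<lambda>z. \<bar>indicator (torusQ \<times> {0..T}) z * H z\<bar> / \<tau>"])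
    show "integrable lborel (\<lambda>z. \<bar>indicator (torusQ \<times> {0..T}) z * H z\<bar> / \<tau>)"
      using H by (auto simp: set_integrable_def)
    show "AE z in lborel. (\<lambda>n. time_ramp' (ramp_eps n) \<tau> (snd z) * (indicator (torusQ \<times> {0..T}) z * H z))
       \<longlonglongrightarrow> - (indicator (torusQ \<times> {0..\<tau>}) z * H z) / \<tau>"
      \<comment> \<open>At t = \<tau> the derivatives tend to 0 instead of
        \<open>- 1 / \<tau>\<close>, so that slice is discarded as a null set.\<close>
      using AE_snd_neq[of \<tau>]
    proof eventually_elim
      case (elim z)
      have "(\<lambda>n. time_ramp' (ramp_eps n) \<tau> (snd z) * (indicator (torusQ \<times> {0..T}) z * H z))
        \<longlonglongrightarrow> (- indicator {..<\<tau>} (snd z) / \<tau>) * (indicator (torusQ \<times> {0..T}) z * H z)"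
        by (intro tendsto_mult tendsto_const time_ramp'_tendsto)
      also have "(- indicator {..<\<tau>} (snd z) / \<tau>) * (indicator (torusQ \<times> {0..T}) z * H z) = - (indicator (torusQ \<times> {0..\<tau>}) z * H z) / \<tau>"
        using elim \<tau> by (cases z) (auto simp: indicator_def)
      finally show ?case .
    qed
    fix n
    show "AE z in lborel. norm (time_ramp' (ramp_eps n) \<tau> (snd z) * (indicator (torusQ \<times> {0..T}) z * H z))
       \<le> \<bar>indicator (torusQ \<times> {0..T}) z * H z\<bar> / \<tau>"
    proof (rule AE_I2)
      fix z :: "(real^'d) \<times> real"
      have "\<bar>time_ramp' (ramp_eps n) \<tau> (snd z)\<bar> \<le> 1 / \<tau>"
        using time_ramp_bounds(3,4)[OF ramp_eps_pos \<tau>(1), of n "snd z"] by simp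
      then have "\<bar>time_ramp' (ramp_eps n) \<tau> (snd z)\<bar> * \<bar>indicator (torusQ \<times> {0..T}) z * H z\<bar> \<le> 1 / \<tau> * \<bar>indicator (torusQ \<times> {0..T}) z * H z\<bar>"
        by (intro mult_right_mono) auto
      then show "norm (time_ramp' (ramp_eps n) \<tau> (snd z) * (indicator (torusQ \<times> {0..T}) z * H z))
       \<le> \<bar>indicator (torusQ \<times> {0..T}) z * H z\<bar> / \<tau>" by (simp add: abs_mult)
    qed
  qed (use borel_measurable_divide[OF borel_measurable_uminus[OF m2] borel_measurable_const[of \<tau>]]
      borel_measurable_times[OF time_ramp_measurable(2) m1] in simp_all)
  then show ?thesis by (simp add: set_lebesgue_integral_def mult_ac)
qed

text \<open>Meant for the flux term. The value of the limit is kept anonymous, because it only has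
  to disappear with \<tau>; the bound by an integral over \<open>[0, \<tau>]\<close> ensures
  that.\<close>

lemma time_ramp_integral_tendsto:
  fixes H :: "(real^'d) \<times> real \<Rightarrow> real"
  assumes H: "set_integrable lborel (torusQ \<times> {0..T}) H" and \<tau>: "0 < \<tau>" "\<tau> < T"
  shows "\<exists>L. (\<lambda>n. LINT z:torusQ \<times> {0..T}|lborel. time_ramp (ramp_eps n) \<tau> (snd z) * H z) \<longlonglongrightarrow> L
      \<and> \<bar>L\<bar> \<le> (LINT z:torusQ \<times> {0..\<tau>}|lborel. \<bar>H z\<bar>)"
proof (intro exI conjI)
  have m1: "(\<lambda>z. indicator (torusQ \<times> {0..T}) z * H z) \<in> borel_measurable borel"
    using H by (simp add: set_integrable_def integrable_iff_bounded)
  have m3: "(\<lambda>z. max 0 (\<tau> - snd z) / \<tau>) \<in> borel_measurable (borel :: ((real^'d) \<times> real) measure)"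
    by (rule measurable_snd_borel) measurable
  let ?L = "\<integral>z. max 0 (\<tau> - snd z) / \<tau> * (indicator (torusQ \<times> {0..T}) z * H z) \<partial>lborel"
  have "(\<lambda>n. \<integral>z. time_ramp (ramp_eps n) \<tau> (snd z) * (indicator (torusQ \<times> {0..T}) z * H z) \<partial>lborel) \<longlonglongrightarrow> ?L"
  proof (rule integral_dominated_convergence[where w="\<lambda>z. \<bar>indicator (torusQ \<times> {0..T}) z * H z\<bar>"])
    show "integrable lborel (\<lambda>z. \<bar>indicator (torusQ \<times> {0..T}) z * H z\<bar>)"
      using H by (auto simp: set_integrable_def)
    show "AE z in lborel. (\<lambda>n. time_ramp (ramp_eps n) \<tau> (snd z) * (indicator (torusQ \<times> {0..T}) z * H z))
       \<longlonglongrightarrow> max 0 (\<tau> - snd z) / \<tau> * (indicator (torusQ \<times> {0..T}) z * H z)"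
      by (intro AE_I2 tendsto_mult tendsto_const time_ramp_tendsto)
    fix n
    show "AE z in lborel. norm (time_ramp (ramp_eps n) \<tau> (snd z) * (indicator (torusQ \<times> {0..T}) z * H z))
       \<le> \<bar>indicator (torusQ \<times> {0..T}) z * H z\<bar>"
    proof (rule AE_I2)
      fix z :: "(real^'d) \<times> real"
      show "norm (time_ramp (ramp_eps n) \<tau> (snd z) * (indicator (torusQ \<times> {0..T}) z * H z))
         \<le> \<bar>indicator (torusQ \<times> {0..T}) z * H z\<bar>"
      proof (cases "z \<in> torusQ \<times> {0..T}")
        case True
        then have "max 0 (\<tau> - snd z) / \<tau> \<le> 1" using \<tau> by auto
        then have "\<bar>time_ramp (ramp_eps n) \<tau> (snd z)\<bar> \<le> 1"
          using time_ramp_bounds(1,2)[OF ramp_eps_pos \<tau>(1), of n "snd z"] by linarith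
        then show ?thesis by (simp add: abs_mult mult_left_le_one_le)
      qed simp
    qed
  qed (use borel_measurable_times[OF m3 m1] borel_measurable_times[OF time_ramp_measurable(1) m1] in simp_all)
  then show "(\<lambda>n. LINT z:torusQ \<times> {0..T}|lborel. time_ramp (ramp_eps n) \<tau> (snd z) * H z) \<longlonglongrightarrow> ?L"
    by (simp add: set_lebesgue_integral_def mult_ac)
  have "set_integrable lborel (torusQ \<times> {0..\<tau>}) (\<lambda>z. \<bar>H z\<bar>)"
    using set_integrable_abs[OF set_integrable_times_mono[OF H, of \<tau>]] \<tau> by simp
  then have i: "integrable lborel (\<lambda>z. indicator (torusQ \<times> {0..\<tau>}) z * \<bar>H z\<bar>)"
    by (simp add: set_integrable_def)
  have bound: "\<bar>max 0 (\<tau> - snd z) / \<tau> * (indicator (torusQ \<times> {0..T}) z * H z)\<bar> \<le> indicator (torusQ \<times> {0..\<tau>}) z * \<bar>H z\<bar>" for z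
  proof (cases "z \<in> torusQ \<times> {0..\<tau>}")
    case True
    then have "max 0 (\<tau> - snd z) / \<tau> \<le> 1" "0 \<le> max 0 (\<tau> - snd z) / \<tau>" using \<tau> by auto
    moreover have "z \<in> torusQ \<times> {0..T}" using True \<tau> by auto
    ultimately show ?thesis using True \<tau>(1) mult_left_le_one_le[of "\<bar>H z\<bar>" "max 0 (\<tau> - snd z) / \<tau>"]
      by (simp add: abs_mult)
  next
    case False
    then have "max 0 (\<tau> - snd z) / \<tau> * (indicator (torusQ \<times> {0..T}) z * H z) = 0"
      by (cases z) (auto simp: indicator_def)
    then show ?thesis unfolding \<open>_ = 0\<close> by simp
  qed
  have iL: "integrable lborel (\<lambda>z. max 0 (\<tau> - snd z) / \<tau> * (indicator (torusQ \<times> {0..T}) z * H z))"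
    by (rule Bochner_Integration.integrable_bound[OF i])
       (use bound borel_measurable_times[OF m3 m1] in auto)
  have "\<bar>?L\<bar> \<le> (\<integral>z. indicator (torusQ \<times> {0..\<tau>}) z * \<bar>H z\<bar> \<partial>lborel)"
    by (intro order_trans[OF integral_abs_bound] integral_mono[OF integrable_abs[OF iL] i bound])
  then show "\<bar>?L\<bar> \<le> (LINT z:torusQ \<times> {0..\<tau>}|lborel. \<bar>H z\<bar>)"
    by (simp add: set_lebesgue_integral_def)
qed

text \<open>Absolute continuity of the integral, read along sequences so that dominated convergence
  applies: every positive time eventually leaves the interval, and the slice at time 0 is
  null.\<close>

lemma shrinking_integral_tendsto:
  fixes H :: "(real^'d) \<times> real \<Rightarrow> real"
  assumes H: "set_integrable lborel (torusQ \<times> {0..T}) H" and T: "T > 0"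
  shows "((\<lambda>\<tau>. LINT z:torusQ \<times> {0..\<tau>}|lborel. H z) \<longlongrightarrow> 0) (at_right 0)"
  unfolding tendsto_at_iff_sequentially
proof (intro allI impI)
  fix X :: "nat \<Rightarrow> real"
  assume X: "\<forall>i. X i \<in> {0<..} - {0}" "X \<longlonglongrightarrow> 0"
  \<comment> \<open>Capping at \<open>T\<close> keeps each cylinder inside the one on which
    \<open>H\<close> is integrable; the cap is inactive for all late \<open>n\<close>.\<close>
  define Y where "Y n = min (X n) T" for n
  have Y: "Y n > 0" "Y n \<le> T" for n using X T by (auto simp: Y_def)
  have "Y \<longlonglongrightarrow> min 0 T" unfolding Y_def by (intro tendsto_min X tendsto_const)
  then have Y0: "Y \<longlonglongrightarrow> 0" using T by simp
  have meas: "(\<lambda>z. indicator (torusQ \<times> {0..Y n}) z * H z) \<in> borel_measurable borel" for n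
    using set_integrable_times_mono[OF H Y(2)] by (simp add: set_integrable_def integrable_iff_bounded)
  have "(\<lambda>n. \<integral>z. indicator (torusQ \<times> {0..Y n}) z * H z \<partial>lborel) \<longlonglongrightarrow> (\<integral>z. 0 \<partial>(lborel :: ((real^'d) \<times> real) measure))"
  proof (rule integral_dominated_convergence[where w="\<lambda>z. \<bar>indicator (torusQ \<times> {0..T}) z * H z\<bar>"])
    show "integrable lborel (\<lambda>z. \<bar>indicator (torusQ \<times> {0..T}) z * H z\<bar>)"
      using H by (auto simp: set_integrable_def)
    show "AE z in lborel. (\<lambda>n. indicator (torusQ \<times> {0..Y n}) z * H z) \<longlonglongrightarrow> 0"
      using AE_snd_neq[of 0]
    proof eventually_elim
      case (elim z)
      show ?case
      proof (cases "snd z > 0")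
        case True
        then have "\<forall>\<^sub>F n in sequentially. Y n < snd z" using Y0 by (intro order_tendstoD)
        then have "\<forall>\<^sub>F n in sequentially. indicator (torusQ \<times> {0..Y n}) z * H z = 0"
          by eventually_elim (auto simp: indicator_def)
        then show ?thesis by (rule tendsto_eventually)
      next
        case False
        then show ?thesis using elim by (cases z) (auto simp: indicator_def)
      qed
    qed
    fix n
    show "AE z in lborel. norm (indicator (torusQ \<times> {0..Y n}) z * H z) \<le> \<bar>indicator (torusQ \<times> {0..T}) z * H z\<bar>"
      using Y[of n] by (intro AE_I2) (auto simp: indicator_def)
  qed (use meas in auto)
  then have lim: "(\<lambda>n. LINT z:torusQ \<times> {0..Y n}|lborel. H z) \<longlonglongrightarrow> 0"
    by (simp add: set_lebesgue_integral_def)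
  have "\<forall>\<^sub>F n in sequentially. X n < T" using X(2) T by (intro order_tendstoD)
  then have "\<forall>\<^sub>F n in sequentially. (LINT z:torusQ \<times> {0..Y n}|lborel. H z) = ((\<lambda>\<tau>. LINT z:torusQ \<times> {0..\<tau>}|lborel. H z) \<circ> X) n"
    by eventually_elim (simp add: Y_def)
  then show "((\<lambda>\<tau>. LINT z:torusQ \<times> {0..\<tau>}|lborel. H z) \<circ> X) \<longlonglongrightarrow> 0"
    by (rule Lim_transform_eventually[OF lim])
qed

section \<open>Time averages of dissipative measure-valued solutions\<close>

text \<open>The setwise measurability in \<open>young_measure\<close> makes \<nu> a measurable
  kernel into the subprobability measures, where integration of a fixed Borel function is a
  measurable operation.\<close>

lemma young_measure_measurable:
  fixes \<nu> :: "'x::euclidean_space \<Rightarrow> 'a::topological_space measure"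
  assumes "young_measure \<nu>" and g: "g \<in> borel_measurable borel"
  shows "(\<lambda>z. pair (\<nu> z) (g :: 'a \<Rightarrow> 'b::{banach,second_countable_topology})) \<in> borel_measurable borel"
proof -
  have "\<nu> \<in> borel \<rightarrow>\<^sub>M subprob_algebra borel"
    using assms(1) by (intro measurable_subprob_algebra) (auto simp: young_measure_def prob_space_imp_subprob_space)
  then show ?thesis
    unfolding pair_def by (rule measurable_compose) (rule integral_measurable_subprob_algebra[OF g])
qed

text \<open>The hypotheses in reduced form: \<open>entropy_ineq\<close> is stated for nonincreasing
  \<theta>, which is what remains once the concentration term has been discarded by its sign, and
  the initial energy is already that of \<open>v0\<close>. \<open>f_bound\<close> makes every flux
  pairing controlled by the energy.\<close>

locale dissipative_solution = entropy_function \<eta> \<alpha> A p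
  for \<eta> :: "real^'n \<Rightarrow> real" and \<alpha> A p +
  fixes T Mf :: real
    and f :: "real^'n \<Rightarrow> real^'d^'n"
    and \<nu> :: "(real^'d) \<times> real \<Rightarrow> (real^'n) measure"
    and v0 :: "real^'d \<Rightarrow> real^'n"
  assumes T_pos: "T > 0"
    and \<eta>_pos: "\<And>l. \<eta> l > 0"
    and f_cont: "continuous_on UNIV f"
    and f_bound: "\<And>l. norm (f l) \<le> \<eta> l + Mf"
    and \<nu>_young: "young_measure \<nu>"
    and \<nu>_int: "AE z in lborel. z \<in> torusQ \<times> {0..T} \<longrightarrow> integrable (\<nu> z) \<eta>"
    and \<nu>_int2: "set_integrable lborel (torusQ \<times> {0..T}) (\<lambda>z. pair (\<nu> z) \<eta>)"
    and v0_meas: "v0 \<in> borel_measurable (restrict_space lborel torusQ)"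
    and weak_sol: "\<And>\<psi>. \<psi> \<in> C1c_test T \<Longrightarrow>
        (LINT z:torusQ \<times> {0..T}|lborel.
            pair (\<nu> z) (\<lambda>l. l) \<bullet> pd \<psi> (0, 1) z
          + (\<Sum>i\<in>UNIV. \<Sum>a\<in>UNIV. (pd \<psi> (axis a 1, 0) z) $ i * pair (\<nu> z) (\<lambda>l. f l $ i $ a)))
        + (LINT x:torusQ|lborel. v0 x \<bullet> \<psi> (x, 0)) = 0"
    and entropy_ineq: "\<And>\<theta>. \<theta> \<in> C1c_time_nonneg T \<Longrightarrow> (\<And>t. pd \<theta> 1 t \<le> 0) \<Longrightarrow>
        - (LINT z:torusQ \<times> {0..T}|lborel. pd \<theta> 1 (snd z) * pair (\<nu> z) \<eta>)
          \<le> \<theta> 0 * (LINT x:torusQ|lborel. \<eta> (v0 x))"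
begin

section \<open>Pairings with the Young measure and their integrability\<close>

definition energy :: "(real^'d) \<times> real \<Rightarrow> real" where
  "energy z = pair (\<nu> z) \<eta>"

text \<open>Taken from the Young measure at every point, which gives Borel measurability at once;
  the a.e. agreement with \<open>v\<close> on the cylinder is used only at the very end.\<close>

definition mean :: "(real^'d) \<times> real \<Rightarrow> real^'n" where
  "mean z = pair (\<nu> z) (\<lambda>l. l)"

definition flux :: "'n \<Rightarrow> 'd \<Rightarrow> (real^'d) \<times> real \<Rightarrow> real" where
  "flux i a z = pair (\<nu> z) (\<lambda>l. f l $ i $ a)"

definition average :: "real \<Rightarrow> real^'d \<Rightarrow> real^'n" where
  "average \<tau> x = (1 / \<tau>) *\<^sub>R (LINT t:{0..\<tau>}|lborel. mean (x, t))"

lemma measurable_pairings [measurable]: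
  "energy \<in> borel_measurable borel" "mean \<in> borel_measurable borel" "flux i a \<in> borel_measurable borel"
proof -
  have "(\<lambda>l. f l $ i $ a) \<in> borel_measurable borel"
    by (intro borel_measurable_continuous_onI continuous_intros f_cont)
  then show "energy \<in> borel_measurable borel" "mean \<in> borel_measurable borel" "flux i a \<in> borel_measurable borel"
    unfolding energy_def[abs_def] mean_def[abs_def] flux_def[abs_def]
    by (intro young_measure_measurable[OF \<nu>_young]; simp)+
qed

text \<open>The last clause is Jensen's inequality in supporting-plane form: nonnegativity of the
  relative entropy is integrated against the probability measure. The quantifier over
  \<open>b\<close> stands inside the a.e. statement, so that \<open>b\<close> may later depend on
  the point \<open>x\<close>.\<close>

lemma pairing_bounds:
  "AE z in lborel. z \<in> torusQ \<times> {0..T} \<longrightarrow> energy z > 0 \<and> norm (mean z) \<le> 1 + (energy z + A) / \<alpha>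
     \<and> (\<forall>i a. \<bar>flux i a z\<bar> \<le> energy z + Mf) \<and> (\<forall>b. \<eta> b + grad \<eta> b \<bullet> (mean z - b) \<le> energy z)"
  using \<nu>_int
proof eventually_elim
  case (elim z)
  show ?case
  proof
    assume "z \<in> torusQ \<times> {0..T}"
    with elim have int: "integrable (\<nu> z) \<eta>" by blast
    have prob: "prob_space (\<nu> z)" and [measurable_cong, simp]: "sets (\<nu> z) = sets borel"
      using \<nu>_young unfolding young_measure_def by blast+
    interpret prob_space "\<nu> z" by (rule prob)
    have fin: "finite_measure (\<nu> z)" by (rule finite_measure_axioms)
    have id: "integrable (\<nu> z) (\<lambda>l. l)"
      by (rule integrable_of_entropy(1)[OF fin _ int]) measurable
    have "norm (mean z) \<le> (\<integral>l. norm l \<partial>\<nu> z)"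
      unfolding mean_def pair_def by (rule integral_norm_bound)
    also have "\<dots> \<le> (\<integral>l. 1 + (\<eta> l + A) / \<alpha> \<partial>\<nu> z)"
      using id int norm_le by (intro integral_mono) auto
    also have "\<dots> = 1 + (energy z + A) / \<alpha>"
      using int by (simp add: energy_def pair_def prob_space add_divide_distrib)
    finally have 1: "norm (mean z) \<le> 1 + (energy z + A) / \<alpha>" .
    have 2: "\<bar>flux i a z\<bar> \<le> energy z + Mf" for i a
    proof -
      have b: "\<bar>f l $ i $ a\<bar> \<le> \<eta> l + Mf" for l
        using component_le_norm_cart[of "f l $ i" a] Finite_Cartesian_Product.norm_nth_le[of "f l" i] f_bound[of l] by simp
      have [measurable]: "(\<lambda>l. f l $ i $ a) \<in> borel_measurable borel"
        by (intro borel_measurable_continuous_onI continuous_intros f_cont)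
      have i2: "integrable (\<nu> z) (\<lambda>l. \<eta> l + Mf)" using int by simp
      have "integrable (\<nu> z) (\<lambda>l. f l $ i $ a)"
        by (rule Bochner_Integration.integrable_bound[OF i2])
           (auto intro!: AE_I2 order_trans[OF b] abs_ge_self)
      then have "\<bar>flux i a z\<bar> \<le> (\<integral>l. \<eta> l + Mf \<partial>\<nu> z)"
        unfolding flux_def pair_def using i2 b by (intro order_trans[OF integral_abs_bound] integral_mono) auto
      also have "\<dots> = energy z + Mf" using int by (simp add: energy_def pair_def prob_space)
      finally show ?thesis .
    qed
    have 3: "\<eta> b + grad \<eta> b \<bullet> (mean z - b) \<le> energy z" for b
    proof -
      have "\<eta> b + grad \<eta> b \<bullet> (mean z - b) = (\<integral>l. \<eta> b + grad \<eta> b \<bullet> (l - b) \<partial>\<nu> z)"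
        using id by (simp add: mean_def pair_def prob_space inner_diff_right)
      also have "\<dots> \<le> (\<integral>l. \<eta> l \<partial>\<nu> z)"
        using rel_entropy_nonneg[of _ b] id int by (intro integral_mono) (simp_all add: rel_entropy_def algebra_simps)
      finally show ?thesis by (simp add: energy_def pair_def)
    qed
    have 4: "energy z > 0"
      unfolding energy_def pair_def by (rule expectation_greater[OF int]) (simp add: \<eta>_pos)
    show "energy z > 0 \<and> norm (mean z) \<le> 1 + (energy z + A) / \<alpha>
     \<and> (\<forall>i a. \<bar>flux i a z\<bar> \<le> energy z + Mf) \<and> (\<forall>b. \<eta> b + grad \<eta> b \<bullet> (mean z - b) \<le> energy z)"
      using 1 2 3 4 by blast
  qed
qed

lemma integrable_space_time_const: "set_integrable lborel ((torusQ :: (real^'d) set) \<times> {0..T}) (\<lambda>z. c :: real)"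
proof -
  have "emeasure lborel ((torusQ :: (real^'d) set) \<times> {0..T}) = emeasure lborel (torusQ :: (real^'d) set) * ennreal T"
    unfolding lborel_prod[symmetric] using T_pos by (subst lborel.emeasure_pair_measure_Times) auto
  also have "\<dots> < \<infinity>" using emeasure_torusQ(2)[where 'd='d] by (simp add: ennreal_mult_less_top)
  finally show ?thesis unfolding set_integrable_def by (intro integrable_scaleR_left) simp
qed

lemma integrable_energy: "set_integrable lborel (torusQ \<times> {0..T}) energy"
  using \<nu>_int2 by (simp add: energy_def[abs_def])

lemma integrable_dominated_by_energy:
  fixes H :: "_ \<Rightarrow> 'b::{banach,second_countable_topology}"
  assumes "H \<in> borel_measurable borel" "AE z in lborel. z \<in> torusQ \<times> {0..T} \<longrightarrow> norm (H z) \<le> c1 + c2 * energy z"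
  shows "set_integrable lborel (torusQ \<times> {0..T}) H"
  unfolding set_integrable_def
proof (rule Bochner_Integration.integrable_bound)
  have "set_integrable lborel (torusQ \<times> {0..T}) (\<lambda>z. c1 + c2 * energy z)"
    by (intro set_integral_add integrable_space_time_const set_integrable_mult_right integrable_energy)
  then show "integrable lborel (\<lambda>z. indicator (torusQ \<times> {0..T}) z *\<^sub>R (c1 + c2 * energy z))"
    by (simp add: set_integrable_def)
  show "AE z in lborel. norm (indicator (torusQ \<times> {0..T}) z *\<^sub>R H z) \<le> norm (indicator (torusQ \<times> {0..T}) z *\<^sub>R (c1 + c2 * energy z))"
    using assms(2) by eventually_elim (auto simp: indicator_def)
  show "(\<lambda>z. indicator (torusQ \<times> {0..T}) z *\<^sub>R H z) \<in> borel_measurable lborel"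
    using assms(1) by (intro borel_measurable_scaleR borel_measurable_indicator) auto
qed

lemma integrable_mean: "set_integrable lborel (torusQ \<times> {0..T}) mean"
proof (rule integrable_dominated_by_energy)
  show "AE z in lborel. z \<in> torusQ \<times> {0..T} \<longrightarrow> norm (mean z) \<le> (1 + A / \<alpha>) + (1 / \<alpha>) * energy z"
    using pairing_bounds by eventually_elim (auto simp: add_divide_distrib)
qed simp

lemma integrable_flux: "set_integrable lborel (torusQ \<times> {0..T}) (flux i a)"
proof (rule integrable_dominated_by_energy)
  show "AE z in lborel. z \<in> torusQ \<times> {0..T} \<longrightarrow> norm (flux i a z) \<le> Mf + 1 * energy z"
    using pairing_bounds by eventually_elim (auto simp: add.commute)
qed simp

text \<open>As the smoothing disappears, the derivative of the ramp becomes
  \<open>- 1 / \<tau>\<close> on [0, \<tau>) and its initial value becomes 1, so the entropy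
  inequality turns into a bound on the average energy.\<close>

lemma energy_average_le:
  assumes \<tau>: "0 < \<tau>" "\<tau> < T"
  shows "(LINT z:torusQ \<times> {0..\<tau>}|lborel. energy z) / \<tau> \<le> (LINT x:torusQ|lborel. \<eta> (v0 x))"
proof -
  let ?e = "LINT x:torusQ|lborel. \<eta> (v0 x)"
  have "(\<lambda>n. - (LINT z:torusQ \<times> {0..T}|lborel. time_ramp' (ramp_eps n) \<tau> (snd z) * energy z))
     \<longlonglongrightarrow> - (- (LINT z:torusQ \<times> {0..\<tau>}|lborel. energy z) / \<tau>)"
    by (intro tendsto_minus time_ramp'_integral_tendsto integrable_energy \<tau>)
  moreover have "(\<lambda>n. time_ramp (ramp_eps n) \<tau> 0 * ?e) \<longlonglongrightarrow> (max 0 (\<tau> - 0) / \<tau>) * ?e"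
    by (intro tendsto_mult time_ramp_tendsto tendsto_const)
  moreover have "- (LINT z:torusQ \<times> {0..T}|lborel. time_ramp' (ramp_eps n) \<tau> (snd z) * energy z)
      \<le> time_ramp (ramp_eps n) \<tau> 0 * ?e" for n
    using entropy_ineq[OF time_ramp_test(1)[OF ramp_eps_pos \<tau>, of n]]
      time_ramp_bounds(4)[OF ramp_eps_pos \<tau>(1)]
    by (simp add: time_ramp_test(2)[OF ramp_eps_pos \<tau>] energy_def)
  ultimately show ?thesis using \<tau> by (auto dest: LIMSEQ_le)
qed

text \<open>If \<^term>\<open>\<lambda>x. \<eta> (v0 x)\<close> were not integrable, its integral would be the junk value 0, contradicting
  the entropy inequality because the energy is positive.\<close>

lemma integrable_initial_energy: "integrable (restrict_space lborel torusQ) (\<lambda>x. \<eta> (v0 x))"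
proof (rule ccontr)
  assume "\<not> ?thesis"
  then have "(\<integral>x. \<eta> (v0 x) \<partial>restrict_space lborel torusQ) = 0" by (rule not_integrable_integral_eq)
  then have e0: "(LINT x:torusQ|lborel. \<eta> (v0 x)) = 0"
    by (simp add: integral_restrict_space set_lebesgue_integral_def)
  define \<tau> where "\<tau> = T / 2"
  have \<tau>: "0 < \<tau>" "\<tau> < T" using T_pos by (auto simp: \<tau>_def)
  let ?S = "(torusQ :: (real^'d) set) \<times> {0..\<tau>}"
  have "(LINT z:?S|lborel. energy z) \<le> 0"
    using energy_average_le[OF \<tau>] \<tau> by (simp add: e0 field_simps)
  moreover have pos: "AE z in lborel. 0 \<le> indicator ?S z *\<^sub>R energy z"
    using pairing_bounds by eventually_elim (use \<tau> in \<open>auto simp: indicator_def\<close>)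
  moreover have int: "integrable lborel (\<lambda>z. indicator ?S z *\<^sub>R energy z)"
    using set_integrable_times_mono[OF integrable_energy, of \<tau>] \<tau> by (simp add: set_integrable_def)
  ultimately have "(\<integral>z. indicator ?S z *\<^sub>R energy z \<partial>lborel) = 0"
    unfolding set_lebesgue_integral_def by (intro antisym integral_nonneg_AE)
  then have "AE z in lborel. indicator ?S z *\<^sub>R energy z = 0"
    using integral_nonneg_eq_0_iff_AE[OF int pos] by simp
  with pairing_bounds have "AE z in lborel. z \<notin> ?S"
    by eventually_elim (use \<tau> in \<open>auto simp: indicator_def\<close>)
  then have "emeasure lborel ?S = 0"
    using AE_iff_measurable[of ?S lborel "\<lambda>z. z \<notin> ?S"] by simp
  moreover have "emeasure lborel ?S = emeasure lborel (torusQ :: (real^'d) set) * ennreal \<tau>"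
    unfolding lborel_prod[symmetric] using \<tau> by (subst lborel.emeasure_pair_measure_Times) auto
  ultimately show False using emeasure_torusQ(1)[where 'd='d] \<tau> by simp
qed

section \<open>Entropy of the time averages\<close>

lemma average_measurable: "average \<tau> \<in> borel_measurable lborel"
proof -
  have "(\<lambda>(x, t). indicator {0..\<tau>} t *\<^sub>R mean (x, t)) \<in> borel_measurable (lborel \<Otimes>\<^sub>M lborel)"
  proof -
    have "(\<lambda>z. indicator {0..\<tau>} (snd z) *\<^sub>R mean z) \<in> borel_measurable (borel :: ((real^'d) \<times> real) measure)"
      by (intro borel_measurable_scaleR measurable_snd_borel) auto
    then show ?thesis by (simp add: lborel_prod split_beta')
  qed
  then show ?thesis
    unfolding average_def[abs_def] set_lebesgue_integral_def
    by (intro borel_measurable_scaleR borel_measurable_const lborel.borel_measurable_lebesgue_integral)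
qed

text \<open>Jensen once more, now in time. The supporting plane is placed at the average itself, so
  that its linear part integrates to 0 over \<open>[0, \<tau>]\<close>.\<close>

lemma average_entropy_le:
  assumes \<tau>: "0 < \<tau>" "\<tau> < T"
  shows "AE x in lborel. x \<in> torusQ \<longrightarrow> \<eta> (average \<tau> x) \<le> (1 / \<tau>) * (LINT t:{0..\<tau>}|lborel. energy (x, t))"
proof -
  have "AE x in lborel. AE t in lborel. (x, t) \<in> torusQ \<times> {0..T} \<longrightarrow>
      (\<forall>b. \<eta> b + grad \<eta> b \<bullet> (mean (x, t) - b) \<le> energy (x, t))"
    using pairing_bounds
    by (intro lborel_pair.AE_pair[unfolded lborel_prod]) (auto elim: eventually_mono)
  then show ?thesis
    using space_time_fubini(1)[OF set_integrable_times_mono[OF integrable_energy less_imp_le[OF \<tau>(2)]]]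
      space_time_fubini(1)[OF set_integrable_times_mono[OF integrable_mean less_imp_le[OF \<tau>(2)]]]
  proof (eventually_elim, intro impI)
    fix x :: "real^'d"
    assume ae: "AE t in lborel. (x, t) \<in> torusQ \<times> {0..T} \<longrightarrow>
        (\<forall>b. \<eta> b + grad \<eta> b \<bullet> (mean (x, t) - b) \<le> energy (x, t))"
      and "x \<in> torusQ \<longrightarrow> set_integrable lborel {0..\<tau>} (\<lambda>t. energy (x, t))"
      and "x \<in> torusQ \<longrightarrow> set_integrable lborel {0..\<tau>} (\<lambda>t. mean (x, t))"
      and x: "x \<in> torusQ"
    then have ie: "set_integrable lborel {0..\<tau>} (\<lambda>t. energy (x, t))"
      and im: "set_integrable lborel {0..\<tau>} (\<lambda>t. mean (x, t))" using \<tau> by auto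
    show "\<eta> (average \<tau> x) \<le> (1 / \<tau>) * (LINT t:{0..\<tau>}|lborel. energy (x, t))"
    proof -
      define b where "b = average \<tau> x"
      let ?k = "\<eta> b - grad \<eta> b \<bullet> b"
      have ic: "set_integrable lborel {0..\<tau>} (\<lambda>t. ?k)"
        using \<tau> unfolding set_integrable_def by (intro integrable_scaleR_left) simp
      have ig: "set_integrable lborel {0..\<tau>} (\<lambda>t. grad \<eta> b \<bullet> mean (x, t))"
        using integrable_inner_right[OF im[unfolded set_integrable_def], of "grad \<eta> b"]
        by (simp add: set_integrable_def)
      have lc: "(LINT t:{0..\<tau>}|lborel. ?k) = \<tau> * ?k"
        using \<tau> by (simp add: set_lebesgue_integral_def)
      have lg: "(LINT t:{0..\<tau>}|lborel. grad \<eta> b \<bullet> mean (x, t)) = grad \<eta> b \<bullet> (LINT t:{0..\<tau>}|lborel. mean (x, t))"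
        using integral_inner_right[OF im[unfolded set_integrable_def], of "grad \<eta> b"]
        by (simp add: set_lebesgue_integral_def)
      have mb: "(LINT t:{0..\<tau>}|lborel. mean (x, t)) = \<tau> *\<^sub>R b"
        using \<tau> by (simp add: b_def average_def)
      have "\<tau> * \<eta> b = (LINT t:{0..\<tau>}|lborel. ?k + grad \<eta> b \<bullet> mean (x, t))"
        using \<tau> unfolding set_integral_add(2)[OF ic ig] lc lg mb by (simp add: algebra_simps)
      also have "\<dots> \<le> (LINT t:{0..\<tau>}|lborel. energy (x, t))"
      proof (rule set_integral_mono_AE[OF set_integral_add(1)[OF ic ig] ie])
        show "AE t\<in>{0..\<tau>} in lborel. ?k + grad \<eta> b \<bullet> mean (x, t) \<le> energy (x, t)"
          using ae
        proof eventually_elim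
          case (elim t)
          show ?case
          proof
            assume "t \<in> {0..\<tau>}"
            then have "\<eta> b + grad \<eta> b \<bullet> (mean (x, t) - b) \<le> energy (x, t)" using elim x \<tau> by auto
            then show "?k + grad \<eta> b \<bullet> mean (x, t) \<le> energy (x, t)" by (simp add: inner_diff_right)
          qed
        qed
      qed
      finally show ?thesis using \<tau> by (simp add: b_def field_simps)
    qed
  qed
qed

lemma average_energy:
  assumes \<tau>: "0 < \<tau>" "\<tau> < T"
  shows "integrable (restrict_space lborel torusQ) (\<lambda>x. \<eta> (average \<tau> x))"
    and "(\<integral>x. \<eta> (average \<tau> x) \<partial>restrict_space lborel torusQ) \<le> (\<integral>x. \<eta> (v0 x) \<partial>restrict_space lborel torusQ)"
proof -
  define g where "g x = (1 / \<tau>) * (LINT t:{0..\<tau>}|lborel. energy (x, t))" for x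
  have ie: "set_integrable lborel (torusQ \<times> {0..\<tau>}) energy"
    using set_integrable_times_mono[OF integrable_energy, of \<tau>] \<tau> by simp
  have ig: "set_integrable lborel torusQ g"
    unfolding g_def by (intro set_integrable_mult_right space_time_fubini(2) ie)
  have le: "AE x in lborel. x \<in> torusQ \<longrightarrow> \<eta> (average \<tau> x) \<le> g x"
    unfolding g_def by (rule average_entropy_le[OF \<tau>])
  have meas: "(\<lambda>x. \<eta> (average \<tau> x)) \<in> borel_measurable lborel"
    by (rule measurable_compose[OF average_measurable measurable_g])
  have ia: "set_integrable lborel torusQ (\<lambda>x. \<eta> (average \<tau> x))"
    unfolding set_integrable_def
  proof (rule Bochner_Integration.integrable_bound[OF ig[unfolded set_integrable_def]])
    show "(\<lambda>x. indicator torusQ x *\<^sub>R \<eta> (average \<tau> x)) \<in> borel_measurable lborel"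
      using meas by (intro borel_measurable_scaleR borel_measurable_indicator) auto
    show "AE x in lborel. norm (indicator torusQ x *\<^sub>R \<eta> (average \<tau> x)) \<le> norm (indicator torusQ x *\<^sub>R g x)"
      using le
    proof eventually_elim
      case (elim x)
      \<comment> \<open>Positivity of \<eta> turns the one-sided bound into domination.\<close>
      then show ?case using \<eta>_pos[of "average \<tau> x"] by (auto simp: indicator_def)
    qed
  qed
  then show "integrable (restrict_space lborel torusQ) (\<lambda>x. \<eta> (average \<tau> x))"
    by (simp add: integrable_restrict_space set_integrable_def)
  have "(LINT x:torusQ|lborel. \<eta> (average \<tau> x)) \<le> (LINT x:torusQ|lborel. g x)"
    by (rule set_integral_mono_AE[OF ia ig le])
  also have "\<dots> = (LINT z:torusQ \<times> {0..\<tau>}|lborel. energy z) / \<tau>"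
    unfolding g_def by (simp add: space_time_fubini(3)[OF ie])
  also have "\<dots> \<le> (LINT x:torusQ|lborel. \<eta> (v0 x))" by (rule energy_average_le[OF \<tau>])
  finally show "(\<integral>x. \<eta> (average \<tau> x) \<partial>restrict_space lborel torusQ) \<le> (\<integral>x. \<eta> (v0 x) \<partial>restrict_space lborel torusQ)"
    by (simp add: integral_restrict_space set_lebesgue_integral_def)
qed

section \<open>Weak convergence of the time averages to the initial datum\<close>

lemma integrable_v0: "set_integrable lborel torusQ v0"
  using integrable_of_entropy(1)[OF finite_measure_torusQ v0_meas integrable_initial_energy]
  by (simp add: integrable_restrict_space set_integrable_def)

text \<open>The test function is the smoothed ramp in time, \<open>h\<close> in space and the
  \<open>j\<close>-th coordinate vector. The integrability assumptions allow the integral of the sum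
  to be split.\<close>

lemma weak_formulation_separated:
  assumes \<tau>: "0 < \<tau>" "\<tau> < T"
    and h: "\<And>x. (h has_derivative h' x) (at x)" "\<And>e. continuous_on UNIV (\<lambda>x. h' x e)" "periodic_x h"
    and i1: "set_integrable lborel (torusQ \<times> {0..T}) (\<lambda>z. h (fst z) * mean z $ j)"
    and i2: "set_integrable lborel (torusQ \<times> {0..T}) (\<lambda>z. \<Sum>a\<in>UNIV. h' (fst z) (axis a 1) * flux j a z)"
  shows "(LINT z:torusQ \<times> {0..T}|lborel. time_ramp' (ramp_eps n) \<tau> (snd z) * (h (fst z) * mean z $ j))
      + (LINT z:torusQ \<times> {0..T}|lborel. time_ramp (ramp_eps n) \<tau> (snd z) * (\<Sum>a\<in>UNIV. h' (fst z) (axis a 1) * flux j a z))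
      + time_ramp (ramp_eps n) \<tau> 0 * (LINT x:torusQ|lborel. h x * v0 x $ j) = 0"
proof -
  define \<psi> where "\<psi> z = (time_ramp (ramp_eps n) \<tau> (snd z) * h (fst z)) *\<^sub>R (axis j 1 :: real^'n)" for z
  note test = separated_test_function[where j=j and \<theta>="time_ramp (ramp_eps n) \<tau>",
      OF time_ramp_derivative[OF ramp_eps_pos] continuous_on_time_ramp'[OF ramp_eps_pos]
      time_ramp_bounds(5)[OF ramp_eps_pos \<tau>(1)] \<tau>(2) h, folded \<psi>_def[abs_def]]
  have 1: "mean z \<bullet> pd \<psi> (0, 1) z = time_ramp' (ramp_eps n) \<tau> (snd z) * (h (fst z) * mean z $ j)" for z
    by (simp add: test(2) inner_axis)
  have 2: "(\<Sum>i\<in>UNIV. \<Sum>a\<in>UNIV. (pd \<psi> (axis a 1, 0) z) $ i * flux i a z)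
     = time_ramp (ramp_eps n) \<tau> (snd z) * (\<Sum>a\<in>UNIV. h' (fst z) (axis a 1) * flux j a z)" for z
  proof -
    have "(\<Sum>i\<in>UNIV. \<Sum>a\<in>UNIV. (pd \<psi> (axis a 1, 0) z) $ i * flux i a z)
      = (\<Sum>i\<in>UNIV. if i = j then time_ramp (ramp_eps n) \<tau> (snd z) * (\<Sum>a\<in>UNIV. h' (fst z) (axis a 1) * flux j a z) else 0)"
      by (intro sum.cong refl) (auto simp: test(3) axis_def sum_distrib_left mult_ac)
    then show ?thesis by simp
  qed
  have 3: "v0 x \<bullet> \<psi> (x, 0) = time_ramp (ramp_eps n) \<tau> 0 * (h x * v0 x $ j)" for x
    by (simp add: \<psi>_def inner_axis)
  have j1: "set_integrable lborel (torusQ \<times> {0..T}) (\<lambda>z. time_ramp' (ramp_eps n) \<tau> (snd z) * (h (fst z) * mean z $ j))"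
  proof (rule set_integrable_bounded_mult[OF i1])
    show "(\<lambda>z. time_ramp' (ramp_eps n) \<tau> (snd z)) \<in> borel_measurable (lborel :: ((real^'d) \<times> real) measure)" by simp
    show "\<bar>time_ramp' (ramp_eps n) \<tau> (snd z)\<bar> \<le> 1 / \<tau>" for z :: "(real^'d) \<times> real"
      using time_ramp_bounds(3,4)[OF ramp_eps_pos \<tau>(1), of n "snd z"] by simp
  qed
  have j2: "set_integrable lborel (torusQ \<times> {0..T}) (\<lambda>z. time_ramp (ramp_eps n) \<tau> (snd z) * (\<Sum>a\<in>UNIV. h' (fst z) (axis a 1) * flux j a z))"
  proof (rule set_integrable_bounded_mult[OF i2])
    show "(\<lambda>z. time_ramp (ramp_eps n) \<tau> (snd z)) \<in> borel_measurable (lborel :: ((real^'d) \<times> real) measure)" by simp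
    fix z :: "(real^'d) \<times> real" assume "z \<in> torusQ \<times> {0..T}"
    then have "max 0 (\<tau> - snd z) / \<tau> \<le> 1" using \<tau> by auto
    then show "\<bar>time_ramp (ramp_eps n) \<tau> (snd z)\<bar> \<le> 1"
      using time_ramp_bounds(1,2)[OF ramp_eps_pos \<tau>(1), of n "snd z"] by linarith
  qed
  have "(LINT z:torusQ \<times> {0..T}|lborel. mean z \<bullet> pd \<psi> (0, 1) z + (\<Sum>i\<in>UNIV. \<Sum>a\<in>UNIV. (pd \<psi> (axis a 1, 0) z) $ i * flux i a z))
      + (LINT x:torusQ|lborel. v0 x \<bullet> \<psi> (x, 0)) = 0"
    using weak_sol[OF test(1)] by (simp add: mean_def flux_def)
  then show ?thesis unfolding 1 2 3 set_integral_add(2)[OF j1 j2] by simp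
qed

text \<open>As the smoothing disappears the identity becomes
  \<open>- ?I1 / \<tau> + L + ?I0 = 0\<close>. By Fubini \<open>?I1 / \<tau>\<close> is the integral
  of \<open>h\<close> against the average, so the whole discrepancy with \<open>v0\<close> is the
  flux contribution \<open>L\<close>, which lives on \<open>[0, \<tau>]\<close>.\<close>

lemma weak_error_bound:
  assumes \<tau>: "0 < \<tau>" "\<tau> < T"
    and h: "\<And>x. (h has_derivative h' x) (at x)" "\<And>e. continuous_on UNIV (\<lambda>x. h' x e)" "periodic_x h"
    and i1: "set_integrable lborel (torusQ \<times> {0..T}) (\<lambda>z. h (fst z) * mean z $ j)"
    and i2: "set_integrable lborel (torusQ \<times> {0..T}) (\<lambda>z. \<Sum>a\<in>UNIV. h' (fst z) (axis a 1) * flux j a z)"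
    and i3: "set_integrable lborel torusQ (\<lambda>x. h x * v0 x $ j)"
  shows "\<bar>\<integral>x. h x * (average \<tau> x - v0 x) $ j \<partial>restrict_space lborel torusQ\<bar>
      \<le> (LINT z:torusQ \<times> {0..\<tau>}|lborel. \<bar>\<Sum>a\<in>UNIV. h' (fst z) (axis a 1) * flux j a z\<bar>)"
proof -
  let ?I0 = "LINT x:torusQ|lborel. h x * v0 x $ j"
  let ?I1 = "LINT z:torusQ \<times> {0..\<tau>}|lborel. h (fst z) * mean z $ j"
  obtain L where L: "(\<lambda>n. LINT z:torusQ \<times> {0..T}|lborel. time_ramp (ramp_eps n) \<tau> (snd z) * (\<Sum>a\<in>UNIV. h' (fst z) (axis a 1) * flux j a z)) \<longlonglongrightarrow> L"
    "\<bar>L\<bar> \<le> (LINT z:torusQ \<times> {0..\<tau>}|lborel. \<bar>\<Sum>a\<in>UNIV. h' (fst z) (axis a 1) * flux j a z\<bar>)"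
    using time_ramp_integral_tendsto[OF i2 \<tau>] by blast
  have "(\<lambda>n. (LINT z:torusQ \<times> {0..T}|lborel. time_ramp' (ramp_eps n) \<tau> (snd z) * (h (fst z) * mean z $ j))
      + (LINT z:torusQ \<times> {0..T}|lborel. time_ramp (ramp_eps n) \<tau> (snd z) * (\<Sum>a\<in>UNIV. h' (fst z) (axis a 1) * flux j a z))
      + time_ramp (ramp_eps n) \<tau> 0 * ?I0) \<longlonglongrightarrow> - ?I1 / \<tau> + L + (max 0 (\<tau> - 0) / \<tau>) * ?I0"
    by (intro tendsto_add tendsto_mult tendsto_const time_ramp'_integral_tendsto[OF i1 \<tau>] L(1) time_ramp_tendsto)
  then have "(\<lambda>n. 0) \<longlonglongrightarrow> - ?I1 / \<tau> + L + (max 0 (\<tau> - 0) / \<tau>) * ?I0"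
    by (simp only: weak_formulation_separated[OF \<tau> h i1 i2])
  then have "- ?I1 / \<tau> + L + (max 0 (\<tau> - 0) / \<tau>) * ?I0 = 0" by (simp add: LIMSEQ_const_iff)
  then have LI: "?I1 / \<tau> - ?I0 = L" using \<tau> by simp
  have i1': "set_integrable lborel (torusQ \<times> {0..\<tau>}) (\<lambda>z. h (fst z) * mean z $ j)"
    using set_integrable_times_mono[OF i1, of \<tau>] \<tau> by simp
  have im: "set_integrable lborel (torusQ \<times> {0..\<tau>}) mean"
    using set_integrable_times_mono[OF integrable_mean, of \<tau>] \<tau> by simp
  have inner: "AE x in lborel. x \<in> torusQ \<longrightarrow> (1 / \<tau>) * (LINT t:{0..\<tau>}|lborel. h x * mean (x, t) $ j) = h x * average \<tau> x $ j"
    using space_time_fubini(1)[OF im]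
  proof (eventually_elim, intro impI)
    fix x :: "real^'d" assume "x \<in> torusQ \<longrightarrow> set_integrable lborel {0..\<tau>} (\<lambda>t. mean (x, t))" "x \<in> torusQ"
    then have "integrable lborel (\<lambda>t. indicator {0..\<tau>} t *\<^sub>R mean (x, t))" by (simp add: set_integrable_def)
    from integral_bounded_linear[OF bounded_linear_vec_nth this, of j]
    have "(LINT t:{0..\<tau>}|lborel. mean (x, t) $ j) = (LINT t:{0..\<tau>}|lborel. mean (x, t)) $ j"
      by (simp add: set_lebesgue_integral_def)
    then show "(1 / \<tau>) * (LINT t:{0..\<tau>}|lborel. h x * mean (x, t) $ j) = h x * average \<tau> x $ j"
      by (simp add: average_def)
  qed
  have ij: "set_integrable lborel torusQ (\<lambda>x. (1 / \<tau>) * (LINT t:{0..\<tau>}|lborel. h x * mean (x, t) $ j))"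
    using space_time_fubini(2)[OF i1'] by (intro set_integrable_mult_right) simp
  have I1: "?I1 / \<tau> = (LINT x:torusQ|lborel. (1 / \<tau>) * (LINT t:{0..\<tau>}|lborel. h x * mean (x, t) $ j))"
    using space_time_fubini(3)[OF i1'] by simp
  have "?I1 / \<tau> - ?I0 = (LINT x:torusQ|lborel. (1 / \<tau>) * (LINT t:{0..\<tau>}|lborel. h x * mean (x, t) $ j) - h x * v0 x $ j)"
    unfolding I1 by (rule set_integral_diff(2)[OF ij i3, symmetric])
  also have "\<dots> = (LINT x:torusQ|lborel. h x * (average \<tau> x - v0 x) $ j)"
    unfolding set_lebesgue_integral_def[of lborel torusQ]
  proof (rule integral_cong_AE)
    have hm: "h \<in> borel_measurable borel"
      by (intro borel_measurable_continuous_onI continuous_at_imp_continuous_on ballI has_derivative_continuous[OF h(1)])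
    have vm: "(\<lambda>x. indicator torusQ x *\<^sub>R v0 x) \<in> borel_measurable borel"
      using integrable_v0 by (simp add: set_integrable_def integrable_iff_bounded)
    have am: "average \<tau> \<in> borel_measurable borel" using average_measurable by simp
    have "(\<lambda>x. h x * (indicator torusQ x * average \<tau> x $ j - (indicator torusQ x *\<^sub>R v0 x) $ j)) \<in> borel_measurable borel"
      by (intro borel_measurable_times borel_measurable_diff hm borel_measurable_indicator torusQ_borel
          measurable_compose[OF am borel_measurable_continuous_onI[OF continuous_on_component[OF continuous_on_id]]]
          measurable_compose[OF vm borel_measurable_continuous_onI[OF continuous_on_component[OF continuous_on_id]]])
    then show "(\<lambda>x. indicator torusQ x *\<^sub>R (h x * (average \<tau> x - v0 x) $ j)) \<in> borel_measurable lborel"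
      by (simp add: algebra_simps)
    show "(\<lambda>x. indicator torusQ x *\<^sub>R ((1 / \<tau>) * (LINT t:{0..\<tau>}|lborel. h x * mean (x, t) $ j) - h x * v0 x $ j)) \<in> borel_measurable lborel"
      using set_integral_diff(1)[OF ij i3] by (auto simp: set_integrable_def)
    show "AE x in lborel. indicator torusQ x *\<^sub>R ((1 / \<tau>) * (LINT t:{0..\<tau>}|lborel. h x * mean (x, t) $ j) - h x * v0 x $ j)
      = indicator torusQ x *\<^sub>R (h x * (average \<tau> x - v0 x) $ j)"
      using inner by eventually_elim (auto simp: indicator_def right_diff_distrib)
  qed
  also have "\<dots> = (\<integral>x. h x * (average \<tau> x - v0 x) $ j \<partial>restrict_space lborel torusQ)"
    by (simp add: integral_restrict_space set_lebesgue_integral_def)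
  finally show ?thesis using L(2) LI by simp
qed

text \<open>\<open>h\<close> and its derivatives are continuous, hence bounded on the torus, so the
  error bound is the integral of one fixed integrable function over a cylinder whose height \<tau>
  shrinks to 0.\<close>

lemma smooth_weak_convergence:
  assumes h: "\<And>x. (h has_derivative h' x) (at x)" "\<And>e. continuous_on UNIV (\<lambda>x. h' x e)" "periodic_x h"
  shows "((\<lambda>\<tau>. \<integral>x. h x * (average \<tau> x - v0 x) $ j \<partial>restrict_space lborel torusQ) \<longlongrightarrow> 0) (at_right 0)"
proof -
  have hc: "continuous_on UNIV h"
    by (intro continuous_at_imp_continuous_on ballI has_derivative_continuous[OF h(1)])
  have meas: "(\<lambda>z. g (fst z)) \<in> borel_measurable (lborel :: ((real^'d) \<times> real) measure)" if "continuous_on UNIV g" for g :: "real^'d \<Rightarrow> real"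
    using borel_measurable_continuous_onI[OF continuous_on_compose2[OF that continuous_on_fst[OF continuous_on_id] subset_UNIV]] by simp
  obtain K where K: "\<And>x. x \<in> torusQ \<Longrightarrow> \<bar>h x\<bar> \<le> K" using continuous_bounded_torusQ[OF hc] by blast
  have mj: "set_integrable lborel (torusQ \<times> {0..T}) (\<lambda>z. mean z $ j)"
    using integrable_bounded_linear[OF bounded_linear_vec_nth integrable_mean[unfolded set_integrable_def], of j]
    by (simp add: set_integrable_def)
  have v0j: "set_integrable lborel torusQ (\<lambda>x. v0 x $ j)"
    using integrable_bounded_linear[OF bounded_linear_vec_nth integrable_v0[unfolded set_integrable_def], of j]
    by (simp add: set_integrable_def)
  have i1: "set_integrable lborel (torusQ \<times> {0..T}) (\<lambda>z. h (fst z) * mean z $ j)"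
    by (rule set_integrable_bounded_mult[OF mj meas[OF hc], where K=K]) (auto intro: K)
  have i3: "set_integrable lborel torusQ (\<lambda>x. h x * v0 x $ j)"
    using borel_measurable_continuous_onI[OF hc] by (intro set_integrable_bounded_mult[OF v0j, where K=K] K) auto
  have i2: "set_integrable lborel (torusQ \<times> {0..T}) (\<lambda>z. \<Sum>a\<in>UNIV. h' (fst z) (axis a 1) * flux j a z)"
  proof -
    have "set_integrable lborel (torusQ \<times> {0..T}) (\<lambda>z. h' (fst z) (axis a 1) * flux j a z)" for a
    proof -
      obtain K' where "\<And>x. x \<in> torusQ \<Longrightarrow> \<bar>h' x (axis a 1)\<bar> \<le> K'"
        using continuous_bounded_torusQ[OF h(2)] by blast
      then show ?thesis
        by (intro set_integrable_bounded_mult[OF integrable_flux meas[OF h(2)], where K=K']) auto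
    qed
    then show ?thesis
      unfolding set_integrable_def scaleR_sum_right by (intro Bochner_Integration.integrable_sum)
  qed
  show ?thesis
  proof (rule Lim_null_comparison)
    have "\<forall>\<^sub>F \<tau> in at_right 0. 0 < \<tau> \<and> \<tau> < T"
      using T_pos eventually_at_right_real[of 0 T] by (simp add: greaterThanLessThan_def)
    then show "\<forall>\<^sub>F \<tau> in at_right 0. norm (\<integral>x. h x * (average \<tau> x - v0 x) $ j \<partial>restrict_space lborel torusQ)
        \<le> (LINT z:torusQ \<times> {0..\<tau>}|lborel. \<bar>\<Sum>a\<in>UNIV. h' (fst z) (axis a 1) * flux j a z\<bar>)"
      by eventually_elim (use weak_error_bound[OF _ _ h i1 i2 i3] in auto)
    show "((\<lambda>\<tau>. LINT z:torusQ \<times> {0..\<tau>}|lborel. \<bar>\<Sum>a\<in>UNIV. h' (fst z) (axis a 1) * flux j a z\<bar>) \<longlongrightarrow> 0) (at_right 0)"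
      by (rule shrinking_integral_tendsto[OF set_integrable_abs[OF i2] T_pos])
  qed
qed

lemma eventually_average:
  "\<forall>\<^sub>F \<tau> in at_right 0. average \<tau> \<in> borel_measurable (restrict_space lborel torusQ)
    \<and> integrable (restrict_space lborel torusQ) (\<lambda>x. \<eta> (average \<tau> x))
    \<and> (\<integral>x. \<eta> (average \<tau> x) \<partial>restrict_space lborel torusQ) \<le> (\<integral>x. \<eta> (v0 x) \<partial>restrict_space lborel torusQ)"
proof -
  have "\<forall>\<^sub>F \<tau> in at_right 0. 0 < \<tau> \<and> \<tau> < T"
    using T_pos eventually_at_right_real[of 0 T] by (simp add: greaterThanLessThan_def)
  then show ?thesis
    by eventually_elim (use average_energy average_measurable in \<open>auto intro: measurable_restrict_space1\<close>)
qed

text \<open>The energy bound yields an L2 bound uniform in \<tau>. With it, orthant indicators are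
  reached as a.e. limits of periodic bumps, and the Dynkin argument extends the convergence to Borel
  sets.\<close>

lemma borel_weak_convergence:
  assumes "B \<in> sets borel"
  shows "((\<lambda>\<tau>. \<integral>x. indicator B x * (average \<tau> x - v0 x) $ j \<partial>restrict_space lborel torusQ) \<longlongrightarrow> 0) (at_right 0)"
proof -
  let ?M = "restrict_space lborel (torusQ :: (real^'d) set)"
  interpret M: finite_measure ?M by (rule finite_measure_torusQ)
  have spM: "space ?M = torusQ" by (simp add: space_restrict_space)
  \<comment> \<open>Majorant from |x - y|^2 <= 2 |x|^2 + 2 |y|^2, with \<open>square_norm_le\<close>
    applied to each term.\<close>
  define G where "G x y = 2 * (1 + (\<eta> x + A) / \<alpha>) + 2 * (1 + (\<eta> y + A) / \<alpha>)" for x y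
  \<comment> \<open>Putting \<open>v0\<close> in both slots frees the bound of \<tau>; it is an
    upper bound because the averages carry no more entropy than \<open>v0\<close>.\<close>
  define K where "K = (\<integral>x. G (v0 x) (v0 x) \<partial>?M)"
  have sq: "((x - y) $ j)\<^sup>2 \<le> G x y" for x y
  proof -
    have "((x - y) $ j)\<^sup>2 \<le> (norm (x - y))\<^sup>2"
      using component_le_norm_cart[of "x - y" j] by (metis abs_ge_zero power2_abs power_mono)
    also have "\<dots> \<le> (norm x + norm y)\<^sup>2" by (intro power_mono norm_triangle_ineq4) auto
    also have "\<dots> \<le> 2 * (norm x)\<^sup>2 + 2 * (norm y)\<^sup>2"
      using sum_squares_bound[of "norm x" "norm y"] by (simp add: power2_sum)
    also have "\<dots> \<le> G x y" unfolding G_def by (intro add_mono mult_left_mono square_norm_le) auto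
    finally show ?thesis .
  qed
  have u: "\<forall>\<^sub>F \<tau> in at_right 0. (\<lambda>x. (average \<tau> x - v0 x) $ j) \<in> borel_measurable ?M
      \<and> integrable ?M (\<lambda>x. ((average \<tau> x - v0 x) $ j)\<^sup>2) \<and> (\<integral>x. ((average \<tau> x - v0 x) $ j)\<^sup>2 \<partial>?M) \<le> K"
    using eventually_average
  proof eventually_elim
    case (elim \<tau>)
    have m: "(\<lambda>x. (average \<tau> x - v0 x) $ j) \<in> borel_measurable ?M"
      using elim v0_meas
      by (intro measurable_compose[OF borel_measurable_diff borel_measurable_continuous_onI[OF continuous_on_component[OF continuous_on_id]]]) auto
    have iG: "integrable ?M (\<lambda>x. G (average \<tau> x) (v0 x))" "integrable ?M (\<lambda>x. G (v0 x) (v0 x))"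
      unfolding G_def using elim integrable_initial_energy by auto
    have i: "integrable ?M (\<lambda>x. ((average \<tau> x - v0 x) $ j)\<^sup>2)"
      by (rule Bochner_Integration.integrable_bound[OF iG(1)])
         (use m in \<open>auto intro!: AE_I2 order_trans[OF sq] borel_measurable_power simp del: vector_minus_component\<close>)
    have "(\<integral>x. ((average \<tau> x - v0 x) $ j)\<^sup>2 \<partial>?M) \<le> (\<integral>x. G (average \<tau> x) (v0 x) \<partial>?M)"
      by (intro integral_mono i iG sq)
    also have "\<dots> \<le> K"
    proof -
      have "K - (\<integral>x. G (average \<tau> x) (v0 x) \<partial>?M) = (\<integral>x. (2 / \<alpha>) * (\<eta> (v0 x) - \<eta> (average \<tau> x)) \<partial>?M)"
        unfolding K_def Bochner_Integration.integral_diff[OF iG(2,1), symmetric]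
        by (simp add: G_def add_divide_distrib diff_divide_distrib algebra_simps)
      also have "\<dots> = (2 / \<alpha>) * ((\<integral>x. \<eta> (v0 x) \<partial>?M) - (\<integral>x. \<eta> (average \<tau> x) \<partial>?M))"
        using elim integrable_initial_energy by simp
      also have "\<dots> \<ge> 0" using elim \<alpha>_pos by simp
      finally show ?thesis by simp
    qed
    finally show ?case using m i by blast
  qed
  show ?thesis
  proof (rule weak_convergence_borel[OF M.finite_measure_axioms _ u _ _ assms])
    show "(\<lambda>x. x) \<in> borel_measurable ?M" by (intro measurable_restrict_space1) simp
    show "((\<lambda>\<tau>. \<integral>x. (average \<tau> x - v0 x) $ j \<partial>?M) \<longlongrightarrow> 0) (at_right 0)"
      using smooth_weak_convergence[of "\<lambda>_. 1" "\<lambda>_ _. 0" j] by (simp add: periodic_x_def)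
    fix a :: "real^'d"
    let ?b = "\<chi> i. min (max (a $ i) 0) (2 * pi)"
    show "((\<lambda>\<tau>. \<integral>x. indicator {..a} x * (average \<tau> x - v0 x) $ j \<partial>?M) \<longlongrightarrow> 0) (at_right 0)"
    proof (rule M.weak_closure[OF u])
      fix k
      obtain h' where h': "\<And>x. (torus_bump k ?b has_derivative h' x) (at x)" "\<And>e. continuous_on UNIV (\<lambda>x. h' x e)"
        using torus_bump_C1(1)[of k ?b] by blast
      show "((\<lambda>\<tau>. \<integral>x. torus_bump k ?b x * (average \<tau> x - v0 x) $ j \<partial>?M) \<longlongrightarrow> 0) (at_right 0)"
        by (rule smooth_weak_convergence[OF h' torus_bump_C1(2)])
      have "continuous_on UNIV (torus_bump k ?b)"
        by (intro continuous_at_imp_continuous_on ballI has_derivative_continuous[OF h'(1)])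
      then show "torus_bump k ?b \<in> borel_measurable ?M"
        by (intro measurable_restrict_space1) (simp add: borel_measurable_continuous_onI)
      show "\<bar>torus_bump k ?b x\<bar> \<le> 1" for x using torus_bump_bounds[of k ?b x] by simp
    next
      show "indicator {..a} \<in> borel_measurable ?M" by (intro measurable_restrict_space1) simp
      show "\<bar>indicator {..a} x :: real\<bar> \<le> 1" for x by (simp add: indicator_def)
      have neq: "AE x in lborel. \<forall>i. x $ i \<noteq> c i" for c :: "'d \<Rightarrow> real"
      proof -
        have "AE x in lborel. \<forall>i\<in>UNIV. (x :: real^'d) $ i \<noteq> c i"
        proof (rule AE_finite_allI)
          fix i
          show "AE x in lborel. (x :: real^'d) $ i \<noteq> c i"
            using AE_lborel_inner_neq[of "axis i 1 :: real^'d" "c i"] by (simp add: inner_axis axis_in_Basis_iff)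
        qed simp
        then show ?thesis by simp
      qed
      have "AE x in lborel. x \<in> torusQ \<longrightarrow> (\<lambda>k. torus_bump k ?b x) \<longlonglongrightarrow> indicator {..a} x"
        using neq[of "\<lambda>_. 0"] neq[of "\<lambda>i. a $ i"]
        by eventually_elim (auto intro!: torus_bump_tendsto)
      then show "AE x in ?M. (\<lambda>k. torus_bump k ?b x) \<longlonglongrightarrow> indicator {..a} x"
        by (simp add: AE_restrict_space_iff)
    qed
  qed
qed

lemma average_converges_Lp:
  "((\<lambda>\<tau>. \<integral>\<^sup>+x\<in>torusQ. ennreal (norm (average \<tau> x - v0 x) powr p) \<partial>lborel) \<longlongrightarrow> 0) (at_right 0)"
proof -
  have "((\<lambda>\<tau>. \<integral>\<^sup>+x. ennreal (norm (average \<tau> x - v0 x) powr p) \<partial>restrict_space lborel torusQ) \<longlongrightarrow> 0) (at_right 0)"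
  proof (rule Lp_convergence[OF finite_measure_torusQ v0_meas integrable_initial_energy eventually_average])
    fix B :: "(real^'d) set" and i
    assume "B \<in> sets (restrict_space lborel torusQ)"
    then have "B \<in> sets borel" by (simp add: sets_restrict_space_iff)
    then show "((\<lambda>\<tau>. \<integral>x. indicator B x * (average \<tau> x - v0 x) $ i \<partial>restrict_space lborel torusQ) \<longlongrightarrow> 0) (at_right 0)"
      by (rule borel_weak_convergence)
  qed
  then show ?thesis by (simp add: nn_integral_restrict_space)
qed

end

section \<open>Reduction of the hypotheses to the locale, and return from \<open>mean\<close> to
  \<open>v\<close>\<close>

theorem theorem4p3:
  fixes T p \<alpha>0 A C \<gamma>0 :: real
    and f :: "real^'n \<Rightarrow> real^'d^'n"
    and \<eta> :: "real^'n \<Rightarrow> real"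
    and q :: "real^'n \<Rightarrow> real^'d"
    and \<nu> :: "(real^'d) \<times> real \<Rightarrow> (real^'n) measure"
    and \<mu> :: "real^'d \<Rightarrow> (real^'n) measure"
    and \<gamma> :: "((real^'d) \<times> real) measure"
    and \<zeta> :: "(real^'d) measure"
    and v :: "(real^'d) \<times> real \<Rightarrow> real^'n"
    and v0 :: "real^'d \<Rightarrow> real^'n"
    and v\<epsilon> :: "nat \<Rightarrow> (real^'d) \<times> real \<Rightarrow> real^'n"
    and v0\<epsilon> :: "nat \<Rightarrow> real^'d \<Rightarrow> real^'n"
  assumes T_pos: "T > 0"
    and p_ge: "p \<ge> 2"
    and consts_pos: "\<alpha>0 > 0" "A > 0" "C > 0" "\<gamma>0 > 0"
    (* the system and the entropy pair *)
    and f_C2: "C2 f" and \<eta>_C2: "C2 \<eta>" and q_C2: "C2 q"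
    and entropy_flux: "\<And>l i a. (\<Sum>j\<in>UNIV. pd \<eta> (axis j 1) l * (pd f (axis i 1) l $ j $ a))
                                 = pd q (axis i 1) l $ a"
    and \<eta>_pos: "\<And>l. \<eta> l > 0"
    and \<eta>_strictly_convex: "strictly_convex \<eta>"
    and \<eta>_hessian: "\<And>l \<xi>. (\<Sum>i\<in>UNIV. \<Sum>j\<in>UNIV. pd (pd \<eta> (axis i 1)) (axis j 1) l * \<xi> $ i * \<xi> $ j)
                          \<ge> \<gamma>0 * norm \<xi> ^ 2"
    and \<eta>_lower: "\<And>l. \<alpha>0 * (norm l powr p + 1) - A \<le> \<eta> l"
    and \<eta>_upper: "\<And>l. \<eta> l \<le> C * (norm l powr p + 1)"
    and f_over_\<eta>: "((\<lambda>l. norm (f l) / \<eta> l) \<longlongrightarrow> 0) at_infinity"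
    (* Young measures and concentration measures *)
    and \<nu>_young: "young_measure \<nu>"
    and \<mu>_young: "young_measure \<mu>"
    and \<nu>_\<eta>_int: "AE z in lborel. z \<in> torusQ \<times> {0..T} \<longrightarrow> integrable (\<nu> z) \<eta>"
    and \<nu>_\<eta>_int2: "set_integrable lborel (torusQ \<times> {0..T}) (\<lambda>z. pair (\<nu> z) \<eta>)"
    and \<gamma>_sets: "sets \<gamma> = sets borel"
    and \<gamma>_supp: "emeasure \<gamma> (UNIV - torusQ \<times> {0..T}) = 0"
    and \<gamma>_fin: "emeasure \<gamma> (torusQ \<times> {0..T}) < \<infinity>"
    and \<zeta>_sets: "sets \<zeta> = sets borel"
    and \<zeta>_supp: "emeasure \<zeta> (UNIV - torusQ) = 0"
    and \<zeta>_fin: "emeasure \<zeta> torusQ < \<infinity>"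
    (* the approximating sequences *)
    and v\<epsilon>_meas: "\<And>k. v\<epsilon> k \<in> borel_measurable lborel"
    and v0\<epsilon>_meas: "\<And>k. v0\<epsilon> k \<in> borel_measurable lborel"
    and v\<epsilon>_bdd: "\<exists>M::real. \<forall>k. AE t in lborel. 0 < t \<and> t < T \<longrightarrow>
                    (\<integral>\<^sup>+x\<in>torusQ. ennreal (norm (v\<epsilon> k (x, t)) powr p) \<partial>lborel) \<le> ennreal M"
    and young_lim: "\<And>g \<phi>. continuous_on UNIV g \<Longrightarrow> ((\<lambda>l. g l / \<eta> l) \<longlongrightarrow> 0) at_infinity \<Longrightarrow>
        \<phi> \<in> cont_test_xt \<Longrightarrow>
        (\<lambda>k. LINT z:torusQ \<times> {0..T}|lborel. \<phi> z * g (v\<epsilon> k z))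
          \<longlonglongrightarrow> (LINT z:torusQ \<times> {0..T}|lborel. \<phi> z * pair (\<nu> z) g)"
    and young_lim0: "\<And>g \<phi>. continuous_on UNIV g \<Longrightarrow> ((\<lambda>l. g l / \<eta> l) \<longlongrightarrow> 0) at_infinity \<Longrightarrow>
        \<phi> \<in> cont_test_x \<Longrightarrow>
        (\<lambda>k. LINT x:torusQ|lborel. \<phi> x * g (v0\<epsilon> k x))
          \<longlonglongrightarrow> (LINT x:torusQ|lborel. \<phi> x * pair (\<mu> x) g)"
    and conc_lim: "\<And>\<phi>. \<phi> \<in> cont_test_xt \<Longrightarrow>
        (\<lambda>k. LINT z:torusQ \<times> {0..T}|lborel. \<phi> z * \<eta> (v\<epsilon> k z))
          \<longlonglongrightarrow> (LINT z:torusQ \<times> {0..T}|lborel. \<phi> z * pair (\<nu> z) \<eta>)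
              + (\<integral>z. \<phi> z \<partial>\<gamma>)"
    and conc_lim0: "\<And>\<phi>. \<phi> \<in> cont_test_x \<Longrightarrow>
        (\<lambda>k. LINT x:torusQ|lborel. \<phi> x * \<eta> (v0\<epsilon> k x))
          \<longlonglongrightarrow> (LINT x:torusQ|lborel. \<phi> x * pair (\<mu> x) \<eta>) + (\<integral>x. \<phi> x \<partial>\<zeta>)"
    (* barycenters *)
    and v_meas: "v \<in> borel_measurable lborel"
    and v_bary: "AE z in lborel. z \<in> torusQ \<times> {0..T} \<longrightarrow> v z = pair (\<nu> z) (\<lambda>l. l)"
    and v_bdd: "\<exists>M::real. AE t in lborel. 0 < t \<and> t < T \<longrightarrow>
                    (\<integral>\<^sup>+x\<in>torusQ. ennreal (norm (v (x, t)) powr p) \<partial>lborel) \<le> ennreal M"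
    and v0_bary: "\<And>x. x \<in> torusQ \<Longrightarrow> v0 x = pair (\<mu> x) (\<lambda>l. l)"
    (* weak formulation of the conservation law *)
    and weak_sol: "\<And>\<psi>. \<psi> \<in> C1c_test T \<Longrightarrow>
        (LINT z:torusQ \<times> {0..T}|lborel.
            pair (\<nu> z) (\<lambda>l. l) \<bullet> pd \<psi> (0, 1) z
          + (\<Sum>i\<in>UNIV. \<Sum>a\<in>UNIV. (pd \<psi> (axis a 1, 0) z) $ i * pair (\<nu> z) (\<lambda>l. f l $ i $ a)))
        + (LINT x:torusQ|lborel. v0 x \<bullet> \<psi> (x, 0)) = 0"
    (* dissipation inequality for the entropy *)
    and entropy_ineq: "\<And>\<theta>. \<theta> \<in> C1c_time_nonneg T \<Longrightarrow>
        (LINT z:torusQ \<times> {0..T}|lborel. pd \<theta> 1 (snd z) * pair (\<nu> z) \<eta>)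
        + (\<integral>z. pd \<theta> 1 (snd z) \<partial>\<gamma>)
        + \<theta> 0 * ((LINT x:torusQ|lborel. pair (\<mu> x) \<eta>) + measure \<zeta> torusQ) \<ge> 0"
    (* hypotheses of the theorem *)
    and \<zeta>_zero: "\<And>B. emeasure \<zeta> B = 0"
    and \<mu>_dirac: "\<And>x. x \<in> torusQ \<Longrightarrow> \<mu> x = return borel (v0 x)"
  shows "((\<lambda>\<tau>. \<integral>\<^sup>+x\<in>torusQ.
            ennreal (norm ((1 / \<tau>) *\<^sub>R set_lebesgue_integral lborel {0..\<tau>} (\<lambda>t. v (x, t)) - v0 x) powr p)
          \<partial>lborel) \<longlongrightarrow> 0) (at_right 0)"
proof -
  have \<eta>_C1: "C1 \<eta>" using \<eta>_C2 by (simp add: C2_def)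
  have f_cont: "continuous_on UNIV f" using f_C2 by (intro C1_continuous_on) (simp add: C2_def)
  have quad: "rel_entropy \<eta> a b \<ge> \<gamma>0 / 2 * (norm (a - b))\<^sup>2" for a b
    by (rule rel_entropy_ge[OF \<eta>_C2 \<eta>_hessian])
  \<comment> \<open>The \<open>+ 1\<close> of the growth bound moves into the additive constant,
    which becomes \<open>A - \<alpha>0\<close>.\<close>
  have low: "\<alpha>0 * norm a powr p - (A - \<alpha>0) \<le> \<eta> a" for a
    using \<eta>_lower[of a] by (simp add: algebra_simps)
  \<comment> \<open>Outside a large ball the ratio is below 1, so the norm of \<open>f\<close> is
    below \<eta>; inside it \<open>f\<close> is bounded by continuity and \<eta> is
    positive.\<close>
  obtain Mf where Mf: "norm (f l) \<le> \<eta> l + Mf" for l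
  proof -
    have "\<forall>\<^sub>F l in at_infinity. norm (f l) / \<eta> l < 1"
      using f_over_\<eta> by (rule order_tendstoD) simp
    then obtain R where R: "\<And>l. R \<le> norm l \<Longrightarrow> norm (f l) / \<eta> l < 1" by (auto simp: eventually_at_infinity)
    have "bounded (f ` cball 0 R)"
      by (intro compact_imp_bounded compact_continuous_image compact_cball continuous_on_subset[OF f_cont]) auto
    then obtain M where M: "M > 0" "\<And>l. norm l \<le> R \<Longrightarrow> norm (f l) \<le> M"
      unfolding bounded_pos by auto
    have "norm (f l) \<le> \<eta> l + M" for l
    proof (cases "R \<le> norm l")
      case True
      then have "norm (f l) < \<eta> l" using R[OF True] \<eta>_pos[of l] by (simp add: divide_simps)
      then show ?thesis using M(1) by simp
    next
      case False
      then show ?thesis using M(2)[of l] \<eta>_pos[of l] by simp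
    qed
    then show ?thesis by (rule that)
  qed
  \<comment> \<open>Inherited from the measurability of the kernel \<mu>, of which \<open>v0\<close>
    is the barycentre on the torus.\<close>
  have v0_meas: "v0 \<in> borel_measurable (restrict_space lborel torusQ)"
  proof -
    have "(\<lambda>x. pair (\<mu> x) (\<lambda>l. l)) \<in> borel_measurable (restrict_space lborel torusQ)"
      by (intro measurable_restrict_space1) (simp add: young_measure_measurable[OF \<mu>_young])
    then show ?thesis
      by (rule measurable_cong[THEN iffD1, rotated]) (simp add: v0_bary space_restrict_space)
  qed
  \<comment> \<open>The Dirac hypothesis enters here: no entropy is lost in passing from \<mu> to
    its barycentre.\<close>
  have e0: "(LINT x:torusQ|lborel. pair (\<mu> x) \<eta>) = (LINT x:torusQ|lborel. \<eta> (v0 x))"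
  proof (rule set_lebesgue_integral_cong)
    have "\<eta> \<in> borel_measurable borel" by (intro borel_measurable_continuous_onI C1_continuous_on \<eta>_C1)
    then show "\<forall>x. x \<in> torusQ \<longrightarrow> pair (\<mu> x) \<eta> = \<eta> (v0 x)"
      by (simp add: \<mu>_dirac pair_def integral_return)
  qed simp
  interpret dissipative_solution \<eta> \<alpha>0 "A - \<alpha>0" p T Mf f \<nu> v0
  proof
    show "\<exists>K>0. \<forall>a b. norm b \<le> R \<longrightarrow> norm (a - b) powr p \<le> K * rel_entropy \<eta> a b" for R
      by (rule rel_entropy_coercive[OF \<eta>_C1 _ consts_pos(1) p_ge quad low]) (use consts_pos in simp)
    show "rel_entropy \<eta> a b \<ge> 0" for a b
      using quad[of b a] consts_pos by (intro order_trans[OF _ quad]) auto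
    show "- (LINT z:torusQ \<times> {0..T}|lborel. pd \<theta> 1 (snd z) * pair (\<nu> z) \<eta>)
          \<le> \<theta> 0 * (LINT x:torusQ|lborel. \<eta> (v0 x))"
      if "\<theta> \<in> C1c_time_nonneg T" "\<And>t. pd \<theta> 1 t \<le> 0" for \<theta>
    proof -
      \<comment> \<open>The sign argument that removes \<gamma>. It is safe without an integrability
        check, because a non-integrable function has integral 0 by convention.\<close>
      have "0 \<le> (\<integral>z. - pd \<theta> 1 (snd z) \<partial>\<gamma>)"
        using that(2) by (intro Bochner_Integration.integral_nonneg) auto
      then have "(\<integral>z. pd \<theta> 1 (snd z) \<partial>\<gamma>) \<le> 0" by simp
      moreover have "measure \<zeta> torusQ = 0" by (simp add: measure_def \<zeta>_zero)
      ultimately show ?thesis using entropy_ineq[OF that(1)] by (simp add: e0)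
    qed
  qed (fact \<eta>_C1 low consts_pos p_ge T_pos \<eta>_pos f_cont Mf \<nu>_young \<nu>_\<eta>_int \<nu>_\<eta>_int2 v0_meas weak_sol)+
  \<comment> \<open>Fubini on the exceptional null set: for almost every \<open>x\<close> the two
    functions agree at almost every time, so their time integrals coincide.\<close>
  have ae: "AE x in lborel. AE t in lborel. (x, t) \<in> torusQ \<times> {0..T} \<longrightarrow> v (x, t) = mean (x, t)"
    using v_bary unfolding mean_def by (intro lborel_pair.AE_pair[unfolded lborel_prod])
  have slice_measurable: "(\<lambda>t. g (x, t)) \<in> borel_measurable lborel" if "g \<in> borel_measurable borel"
    for g :: "(real^'d) \<times> real \<Rightarrow> real^'n" and x
    using measurable_compose[OF borel_measurable_continuous_onI[OF continuous_on_Pair[OF continuous_on_const continuous_on_id]] that]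
    by simp
  have "\<forall>\<^sub>F \<tau> in at_right 0. 0 < \<tau> \<and> \<tau> < T"
    using T_pos eventually_at_right_real[of 0 T] by (simp add: greaterThanLessThan_def)
  then have "\<forall>\<^sub>F \<tau> in at_right 0.
      (\<integral>\<^sup>+x\<in>torusQ. ennreal (norm (average \<tau> x - v0 x) powr p) \<partial>lborel)
    = (\<integral>\<^sup>+x\<in>torusQ. ennreal (norm ((1 / \<tau>) *\<^sub>R set_lebesgue_integral lborel {0..\<tau>} (\<lambda>t. v (x, t)) - v0 x) powr p) \<partial>lborel)"
  proof eventually_elim
    case (elim \<tau>)
    show ?case
    proof (rule nn_integral_cong_AE)
      show "AE x in lborel. ennreal (norm (average \<tau> x - v0 x) powr p) * indicator torusQ x
        = ennreal (norm ((1 / \<tau>) *\<^sub>R set_lebesgue_integral lborel {0..\<tau>} (\<lambda>t. v (x, t)) - v0 x) powr p) * indicator torusQ x"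
        using ae
      proof eventually_elim
        case (elim x)
        show ?case
        proof (cases "x \<in> torusQ")
          case True
          have "set_lebesgue_integral lborel {0..\<tau>} (\<lambda>t. v (x, t)) = (LINT t:{0..\<tau>}|lborel. mean (x, t))"
          proof (rule set_lebesgue_integral_cong_AE)
            show "AE t\<in>{0..\<tau>} in lborel. v (x, t) = mean (x, t)"
              using elim by eventually_elim (use True \<open>0 < \<tau> \<and> \<tau> < T\<close> in auto)
          qed (use v_meas in \<open>auto intro!: slice_measurable measurable_pairings\<close>)
          then show ?thesis by (simp add: average_def)
        qed simp
      qed
    qed
  qed
  from Lim_transform_eventually[OF average_converges_Lp this] show ?thesis .
qed

end
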